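(* Let $n\in\{1,2,3\}$, $k\in\mathbb{N}$ ($k=1$ if $n=3$), and for $\omega=\sqrt{m^2-\epsilon^2}$ close to $m$ let $(v,u)$ be the solitary wave profile of the context. Define the $4\times4$ matrix-valued function $W(R,\epsilon)$ whose entries, with $v,u,f,f'$ evaluated at $r=R/\epsilon$, are $W_{13}=\frac1{2m}-\hat V(R)^{2k}-\frac{m-\omega-f}{\epsilon^2}$, $W_{24}=\omega-m-f$, $W_{31}=-\frac1{2m}+(2k+1)\hat V(R)^{2k}-\frac{\omega-m+f+2f'v^2}{\epsilon^2}$, $W_{32}=W_{41}=\frac{2f'vu}{\epsilon}$, $W_{42}=m-\omega+f-2f'u^2$, and all other entries zero. Then $\sup_{R}\|W(R,\epsilon)\|_{\mathbb{C}^4\to\mathbb{C}^4}=O(\epsilon^2)$ as $\epsilon\to0$.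
   Context: Solitary wave profile: with $\epsilon=\sqrt{m^2-\omega^2}$, $(v,u)$ is the real solution of $\omega v=\partial_r u+\frac{n-1}{r}u+mv-(v^2-u^2)^kv$, $\omega u=-\partial_r v-mu+(v^2-u^2)^ku$ (radial variable $r>0$ for $n=2,3$; $r=x\in\mathbb{R}$ for $n=1$) of the form $v(r)=\epsilon^{1/k}[\hat V(\epsilon r)+\tilde V(\epsilon r)]$, $u(r)=\epsilon^{1+1/k}[\hat U(\epsilon r)+\tilde U(\epsilon r)]$ with $\|\tilde V\|_{H^2}+\|\tilde U\|_{H^2}=O(\epsilon^2)$, where $\hat V(R)=(2m)^{-1/(2k)}F(R)$, $\hat U=-(2m)^{-1/(2k)-1}F'$, and $F$ is the unique positive radial $H^1(\mathbb{R}^n)$ solution of $-\Delta F-F^{2k+1}=-F$. Also $f=(v^2-u^2)^k$, $f'=k(v^2-u^2)^{k-1}$. ($W$ is the zero-order remainder obtained when the eigenvalue problem for the linearization $\begin{pmatrix}0&\mathrm{L}_-\\-\mathrm{L}_+&0\end{pmatrix}$ is rescaled by $R=\epsilon r$, $\varphi_2=\epsilon\Phi_2$, $\vartheta_2=\epsilon\Theta_2$, dividing rows 1,3 by $\epsilon^2$ and rows 2,4 by $\epsilon$, and compared with its $\epsilon\to0$ limit.) *)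

theory Defs
  imports "HOL-Analysis.Analysis"
begin

text \<open>Domain of the radial variable: the whole line for n = 1 (r = x), r > 0 for n = 2, 3.\<close>
definition rdom :: "nat \<Rightarrow> real set" where
  "rdom n = (if n = 1 then UNIV else {0<..})"

text \<open>Area of the unit sphere S^(n-1) for n = 2, 3.\<close>
definition sphere_area :: "nat \<Rightarrow> real" where
  "sphere_area n = (if n = 2 then 2 * pi else 4 * pi)"

text \<open>Twice classically differentiable on the (open) radial domain.\<close>
definition C2_on :: "real set \<Rightarrow> (real \<Rightarrow> real) \<Rightarrow> bool" where
  "C2_on D g \<longleftrightarrow> (\<forall>x\<in>D. g differentiable (at x) \<and> deriv g differentiable (at x))"

text \<open>Squared H^1 norm of the radial function x \<mapsto> g(|x|) on R^n (n = 2,3),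
  resp. of g on R (n = 1).\<close>
definition H1_sq :: "nat \<Rightarrow> (real \<Rightarrow> real) \<Rightarrow> ennreal" where
  "H1_sq n g = (if n = 1 then
      (\<integral>\<^sup>+ x. ennreal ((g x)\<^sup>2 + (deriv g x)\<^sup>2) \<partial>lborel)
    else ennreal (sphere_area n) *
      (\<integral>\<^sup>+ r. ennreal (((g r)\<^sup>2 + (deriv g r)\<^sup>2) * r ^ (n - 1)) * indicator {0<..} r \<partial>lborel))"

text \<open>Squared H^2 norm of the radial function x \<mapsto> g(|x|) on R^n (n = 2,3),
  resp. of g on R (n = 1). For radial functions |D^2 g|^2 = g''^2 + (n-1)(g'/r)^2.\<close>
definition H2_sq :: "nat \<Rightarrow> (real \<Rightarrow> real) \<Rightarrow> ennreal" where
  "H2_sq n g = (if n = 1 then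
      (\<integral>\<^sup>+ x. ennreal ((g x)\<^sup>2 + (deriv g x)\<^sup>2 + (deriv (deriv g) x)\<^sup>2) \<partial>lborel)
    else ennreal (sphere_area n) *
      (\<integral>\<^sup>+ r. ennreal (((g r)\<^sup>2 + (deriv g r)\<^sup>2 + (deriv (deriv g) r)\<^sup>2
                 + real (n - 1) * (deriv g r / r)\<^sup>2) * r ^ (n - 1))
             * indicator {0<..} r \<partial>lborel))"

text \<open>Vhat(R) = (2m)^(-1/(2k)) F(R).\<close>
definition Vhat :: "real \<Rightarrow> nat \<Rightarrow> (real \<Rightarrow> real) \<Rightarrow> real \<Rightarrow> real" where
  "Vhat m k F R = (2 * m) powr (- 1 / (2 * real k)) * F R"

text \<open>Uhat(R) = -(2m)^(-1/(2k)-1) F'(R).\<close>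
definition Uhat :: "real \<Rightarrow> nat \<Rightarrow> (real \<Rightarrow> real) \<Rightarrow> real \<Rightarrow> real" where
  "Uhat m k F R = - ((2 * m) powr (- 1 / (2 * real k) - 1) * deriv F R)"

text \<open>The 4x4 matrix W(R,\<epsilon>), with v, u, f, f' evaluated at r = R/\<epsilon>, \<omega> = sqrt(m^2 - \<epsilon>^2).
  Indices 1,2,3,4 of the numeral type 4 are used as labels (4 = 0 in that type).\<close>
definition W_mat :: "real \<Rightarrow> nat \<Rightarrow> (real \<Rightarrow> real) \<Rightarrow> (real \<Rightarrow> real) \<Rightarrow> (real \<Rightarrow> real)
                      \<Rightarrow> real \<Rightarrow> real \<Rightarrow> complex^4^4" where
  "W_mat m k F v u \<epsilon> R =
    (let r = R / \<epsilon>; \<omega> = sqrt (m\<^sup>2 - \<epsilon>\<^sup>2); vv = v r; uu = u r;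
         f = (vv\<^sup>2 - uu\<^sup>2) ^ k; f' = real k * (vv\<^sup>2 - uu\<^sup>2) ^ (k - 1);
         W13 = 1 / (2 * m) - (Vhat m k F R) ^ (2 * k) - (m - \<omega> - f) / \<epsilon>\<^sup>2;
         W24 = \<omega> - m - f;
         W31 = - 1 / (2 * m) + (2 * real k + 1) * (Vhat m k F R) ^ (2 * k)
               - (\<omega> - m + f + 2 * f' * vv\<^sup>2) / \<epsilon>\<^sup>2;
         W32 = 2 * f' * vv * uu / \<epsilon>;
         W41 = 2 * f' * vv * uu / \<epsilon>;
         W42 = m - \<omega> + f - 2 * f' * uu\<^sup>2
     in (\<chi> i j. complex_of_real
          (if i = 1 \<and> j = 3 then W13
           else if i = 2 \<and> j = 4 then W24
           else if i = 3 \<and> j = 1 then W31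
           else if i = 3 \<and> j = 2 then W32
           else if i = 4 \<and> j = 1 then W41
           else if i = 4 \<and> j = 2 then W42
           else 0)))"

text \<open>Operator norm C^4 \<rightarrow> C^4 (Euclidean norms).\<close>
definition mat_opnorm :: "complex^4^4 \<Rightarrow> real" where
  "mat_opnorm M = onorm (\<lambda>x. M *v x)"

end

theory Submission
  imports Defs
begin

(*
  After the substitution r = R / \<epsilon>, write v = \<epsilon>^(1/k) V and u = \<epsilon>^(1+1/k) U with
  V = Vhat + Vt and U = Uhat + Ut.  Then f = \<epsilon>\<^sup>2 P^k with P = V\<^sup>2 - \<epsilon>\<^sup>2 U\<^sup>2, and
  (m - \<omega>) / \<epsilon>\<^sup>2 = 1 / (m + \<omega>) = 1 / (2 m) + O(\<epsilon>\<^sup>2).  The terms of order one in W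
  cancel exactly against 1 / (2 m) and Vhat^(2k), and what is left of every entry is \<epsilon>\<^sup>2 times
  a polynomial in Vhat, Uhat, Vt / \<epsilon>\<^sup>2 and Ut / \<epsilon>\<^sup>2.  So it suffices to bound these four
  quantities uniformly in R.

  For Vt and Ut this is the one-dimensional Sobolev embedding, applied on unit intervals away
  from the origin and, near the origin, through the term (n - 1) (g' / r)\<^sup>2 of the radial H^2
  norm.  For Vhat and Uhat it is the boundedness of the ground state F and of F'.  If n = 1 the
  energy F'\<^sup>2/2 - F\<^sup>2/2 + F^(2k+2)/(2k+2) is conserved.  If n = 2, 3 it decreases on [1, \<infinity>).
  Near the origin the finite H^1 norm gives F \<le> D s^(-a) with (2k+1) a < 2.  Integrating the
  equation (r^(n-1) F')' = r^(n-1) (F - F^(2k+1)) then bounds F', and through it F.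
*)

section \<open>Operator norm of a matrix\<close>

lemma onorm_le_matrix_component_norm:
  fixes A :: "'a::real_normed_div_algebra^'n^'m"
  assumes "\<And>i j. norm (A $ i $ j) \<le> B"
  shows "onorm ((*v) A) \<le> real CARD('m) * real CARD('n) * B"
proof (rule onorm_le)
  fix x :: "'a^'n"
  have "norm (A *v x) \<le> (\<Sum>i\<in>UNIV. norm ((A *v x) $ i))"
    by (simp add: norm_vec_def L2_set_le_sum)
  also have "\<dots> \<le> (\<Sum>i::'m\<in>UNIV. real CARD('n) * B * norm x)"
  proof (rule sum_mono)
    fix i
    have "norm ((A *v x) $ i) \<le> (\<Sum>j\<in>UNIV. norm (A $ i $ j * x $ j))"
      unfolding matrix_vector_mult_def vec_lambda_beta by (rule norm_sum)
    also have "\<dots> \<le> (\<Sum>j::'n\<in>UNIV. B * norm x)"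
    proof (intro sum_mono)
      fix j
      have "0 \<le> B" using order_trans[OF norm_ge_zero assms] .
      then show "norm (A $ i $ j * x $ j) \<le> B * norm x"
        unfolding norm_mult by (intro mult_mono assms Finite_Cartesian_Product.norm_nth_le) auto
    qed
    finally show "norm ((A *v x) $ i) \<le> real CARD('n) * B * norm x" by simp
  qed
  finally show "norm (A *v x) \<le> real CARD('m) * real CARD('n) * B * norm x" by simp
qed

lemma onorm_W_shape_le:
  fixes a13 a24 a31 a32 a41 a42 c :: real
  assumes "\<bar>a13\<bar> \<le> c" "\<bar>a24\<bar> \<le> c" "\<bar>a31\<bar> \<le> c" "\<bar>a32\<bar> \<le> c" "\<bar>a41\<bar> \<le> c" "\<bar>a42\<bar> \<le> c"
  shows "onorm ((*v) ((\<chi> i j. complex_of_real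
          (if i = 1 \<and> j = 3 then a13
           else if i = 2 \<and> j = 4 then a24
           else if i = 3 \<and> j = 1 then a31
           else if i = 3 \<and> j = 2 then a32
           else if i = 4 \<and> j = 1 then a41
           else if i = 4 \<and> j = 2 then a42
           else 0)) :: complex^4^4)) \<le> 16 * c" (is "onorm ((*v) ?W) \<le> _")
proof -
  have "0 \<le> c" using order_trans[OF abs_ge_zero assms(1)] .
  then have "norm (?W $ i $ j) \<le> c" for i j using assms by auto
  from onorm_le_matrix_component_norm[OF this] show ?thesis by simp
qed

section \<open>Pointwise bounds from the radial Sobolev norms\<close>

lemma C2_on_imp_C1_on:
  assumes "C2_on D g" "S \<subseteq> D"
  shows "\<And>t. t \<in> S \<Longrightarrow> (g has_real_derivative deriv g t) (at t)"
    and "continuous_on S (deriv g)"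
proof -
  have D: "(g has_real_derivative deriv g t) (at t)" "isCont (deriv g) t" if "t \<in> D" for t
    using assms(1) that unfolding C2_on_def
    by (auto simp: DERIV_deriv_iff_real_differentiable intro: differentiable_imp_continuous_within)
  show "\<And>t. t \<in> S \<Longrightarrow> (g has_real_derivative deriv g t) (at t)" using D(1) assms(2) by blast
  show "continuous_on S (deriv g)" using D(2) assms(2) by (blast intro: continuous_at_imp_continuous_on)
qed

lemma C2_on_has_second_derivative:
  assumes "C2_on D g" "t \<in> D"
  shows "(deriv g has_real_derivative deriv (deriv g) t) (at t)"
  using assms by (simp add: C2_on_def DERIV_deriv_iff_real_differentiable)

lemma nn_integral_indicator_Icc_eq_integral:
  fixes h :: "real \<Rightarrow> real"
  assumes "continuous_on {a..b} h" "\<And>x. x \<in> {a..b} \<Longrightarrow> 0 \<le> h x"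
  shows "(\<integral>\<^sup>+x. ennreal (h x) * indicator {a..b} x \<partial>lborel) = ennreal (integral {a..b} h)"
proof -
  let ?f = "\<lambda>x. indicator {a..b} x *\<^sub>R h x"
  have "?f \<in> borel_measurable borel"
    by (rule borel_measurable_continuous_on_indicator) (auto simp: assms)
  moreover have "\<And>x. 0 \<le> ?f x" using assms(2) by (auto simp: indicator_def)
  moreover have "(?f has_integral integral {a..b} h) UNIV"
  proof -
    have "(h has_integral integral {a..b} h) {a..b}"
      using integrable_continuous_interval[OF assms(1)] by (simp add: has_integral_integral)
    then have "((\<lambda>x. if x \<in> {a..b} then h x else 0) has_integral integral {a..b} h) UNIV"
      by (subst has_integral_restrict_UNIV)
    then show ?thesis by (rule has_integral_eq[rotated]) (simp add: indicator_def)
  qed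
  ultimately have "integral\<^sup>N lborel ?f = ennreal (integral {a..b} h)"
    by (rule nn_integral_has_integral_lborel)
  moreover have "(\<integral>\<^sup>+x. ennreal (h x) * indicator {a..b} x \<partial>lborel) = integral\<^sup>N lborel ?f"
    by (intro nn_integral_cong) (auto simp: indicator_def)
  ultimately show ?thesis by simp
qed

lemma abs_diff_le_integral_abs_deriv:
  fixes g g' :: "real \<Rightarrow> real"
  assumes "a \<le> b" "\<And>x. x \<in> {a..b} \<Longrightarrow> (g has_real_derivative g' x) (at x)"
    "continuous_on {a..b} g'"
  shows "\<bar>g b - g a\<bar> \<le> integral {a..b} (\<lambda>x. \<bar>g' x\<bar>)"
proof -
  have "(g' has_integral (g b - g a)) {a..b}"
    using assms by (intro fundamental_theorem_of_calculus)
      (auto simp: has_real_derivative_iff_has_vector_derivative[symmetric] intro: DERIV_subset)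
  then have "g b - g a = integral {a..b} g'" by (simp add: integral_unique)
  moreover have "norm (integral {a..b} g') \<le> integral {a..b} (\<lambda>x. \<bar>g' x\<bar>)"
    by (rule integral_norm_bound_integral)
      (auto intro!: integrable_continuous_interval continuous_intros assms(3))
  ultimately show ?thesis by simp
qed

lemma sq_le_two_integral_unit_interval:
  fixes g g' :: "real \<Rightarrow> real"
  assumes "\<And>t. t \<in> {x..x+1} \<Longrightarrow> (g has_real_derivative g' t) (at t)"
    "continuous_on {x..x+1} g'"
  shows "(g x)\<^sup>2 \<le> 2 * integral {x..x+1} (\<lambda>t. (g t)\<^sup>2 + (g' t)\<^sup>2)"
proof -
  have gc: "continuous_on {x..x+1} g"
    using assms(1) by (meson DERIV_isCont continuous_at_imp_continuous_on)
  have c2: "continuous_on {x..x+1} (\<lambda>t. (g t)\<^sup>2)" by (intro continuous_intros gc)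
  obtain y where y: "y \<in> {x..x+1}" "\<And>t. t\<in>{x..x+1} \<Longrightarrow> (g y)\<^sup>2 \<le> (g t)\<^sup>2"
    using continuous_attains_inf[OF compact_Icc _ c2] by auto
  have i1: "(\<lambda>t. (g t)\<^sup>2) integrable_on {x..x+1}" by (intro integrable_continuous_interval c2)
  have i2: "(\<lambda>t. (g t)\<^sup>2 + (g' t)\<^sup>2) integrable_on {x..x+1}"
    by (intro integrable_continuous_interval continuous_intros gc assms(2))
  have i3: "(\<lambda>t. \<bar>2 * g t * g' t\<bar>) integrable_on {x..x+1}"
    by (intro integrable_continuous_interval continuous_intros gc assms(2))
  have "(g y)\<^sup>2 = integral {x..x+1} (\<lambda>t. (g y)\<^sup>2)" by simp
  also have "\<dots> \<le> integral {x..x+1} (\<lambda>t. (g t)\<^sup>2)"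
    using y by (intro integral_le i1) auto
  also have "\<dots> \<le> integral {x..x+1} (\<lambda>t. (g t)\<^sup>2 + (g' t)\<^sup>2)"
    by (intro integral_le i1 i2) auto
  finally have min: "(g y)\<^sup>2 \<le> integral {x..x+1} (\<lambda>t. (g t)\<^sup>2 + (g' t)\<^sup>2)" .
  have "\<bar>(g y)\<^sup>2 - (g x)\<^sup>2\<bar> \<le> integral {x..y} (\<lambda>t. \<bar>2 * g t * g' t\<bar>)"
  proof (rule abs_diff_le_integral_abs_deriv)
    fix t assume "t \<in> {x..y}"
    then have "t \<in> {x..x+1}" using y by auto
    from DERIV_mult[OF assms(1)[OF this] assms(1)[OF this]]
    show "((\<lambda>t. (g t)\<^sup>2) has_real_derivative 2 * g t * g' t) (at t)"
      by (simp add: power2_eq_square algebra_simps)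
  qed (use y in \<open>auto intro!: continuous_intros
         continuous_on_subset[OF gc] continuous_on_subset[OF assms(2)]\<close>)
  also have "\<dots> \<le> integral {x..x+1} (\<lambda>t. \<bar>2 * g t * g' t\<bar>)"
    using y by (intro integral_subset_le i3 integrable_on_subinterval[OF i3]) auto
  also have "\<dots> \<le> integral {x..x+1} (\<lambda>t. (g t)\<^sup>2 + (g' t)\<^sup>2)"
  proof (intro integral_le i3 i2)
    fix t
    have "0 \<le> (\<bar>g t\<bar> - \<bar>g' t\<bar>)\<^sup>2" by simp
    then show "\<bar>2 * g t * g' t\<bar> \<le> (g t)\<^sup>2 + (g' t)\<^sup>2"
      by (simp add: power2_eq_square abs_mult algebra_simps)
  qed
  finally show ?thesis using min by linarith
qed

lemma sq_le_of_nn_integral_unit_interval: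
  fixes g g' :: "real \<Rightarrow> real"
  assumes "\<And>t. t \<in> {x..x+1} \<Longrightarrow> (g has_real_derivative g' t) (at t)"
    "continuous_on {x..x+1} g'"
    and "(\<integral>\<^sup>+t. ennreal ((g t)\<^sup>2 + (g' t)\<^sup>2) * indicator {x..x+1} t \<partial>lborel) \<le> ennreal (B\<^sup>2)"
  shows "(g x)\<^sup>2 \<le> 2 * B\<^sup>2"
proof -
  have "continuous_on {x..x+1} g"
    using assms(1) by (meson DERIV_isCont continuous_at_imp_continuous_on)
  then have "(\<integral>\<^sup>+t. ennreal ((g t)\<^sup>2 + (g' t)\<^sup>2) * indicator {x..x+1} t \<partial>lborel)
      = ennreal (integral {x..x+1} (\<lambda>t. (g t)\<^sup>2 + (g' t)\<^sup>2))"
    by (intro nn_integral_indicator_Icc_eq_integral) (auto intro!: continuous_intros assms(2))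
  with assms(3) have "integral {x..x+1} (\<lambda>t. (g t)\<^sup>2 + (g' t)\<^sup>2) \<le> B\<^sup>2"
    by (simp add: ennreal_le_iff)
  with sq_le_two_integral_unit_interval[OF assms(1,2)] show ?thesis by linarith
qed

lemma abs_diff_le_of_nn_integral_deriv_sq:
  fixes g g' :: "real \<Rightarrow> real"
  assumes ab: "a \<le> b" "b \<le> a + 1" and B: "0 < B"
    and g: "\<And>t. t \<in> {a..b} \<Longrightarrow> (g has_real_derivative g' t) (at t)" "continuous_on {a..b} g'"
    and I: "(\<integral>\<^sup>+t. ennreal ((g' t)\<^sup>2) * indicator {a..b} t \<partial>lborel) \<le> ennreal (B\<^sup>2)"
  shows "\<bar>g b - g a\<bar> \<le> B"
proof -
  have "(\<integral>\<^sup>+t. ennreal ((g' t)\<^sup>2) * indicator {a..b} t \<partial>lborel) = ennreal (integral {a..b} (\<lambda>t. (g' t)\<^sup>2))"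
    by (intro nn_integral_indicator_Icc_eq_integral) (auto intro!: continuous_intros g(2))
  with I have I': "integral {a..b} (\<lambda>t. (g' t)\<^sup>2) \<le> B\<^sup>2" by (simp add: ennreal_le_iff)
  have "\<bar>g b - g a\<bar> \<le> integral {a..b} (\<lambda>t. \<bar>g' t\<bar>)"
    by (rule abs_diff_le_integral_abs_deriv[OF ab(1) g])
  also have "\<dots> \<le> integral {a..b} (\<lambda>t. (g' t)\<^sup>2 / (2 * B) + B / 2)"
  proof (rule integral_le)
    show "(\<lambda>t. (g' t)\<^sup>2 / (2 * B) + B / 2) integrable_on {a..b}"
      using B by (intro integrable_continuous_interval continuous_intros g(2)) auto
    show "(\<lambda>t. \<bar>g' t\<bar>) integrable_on {a..b}"
      by (intro integrable_continuous_interval continuous_intros g(2))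
    fix t
    have "0 \<le> (\<bar>g' t\<bar> - B)\<^sup>2" by simp
    then show "\<bar>g' t\<bar> \<le> (g' t)\<^sup>2 / (2 * B) + B / 2"
      using B by (simp add: field_simps power2_eq_square)
  qed
  also have "\<dots> = integral {a..b} (\<lambda>t. (g' t)\<^sup>2) / (2 * B) + B / 2 * (b - a)"
    using ab g(2) B by (subst integral_add)
      (auto intro!: integrable_continuous_interval continuous_intros simp: integral_divide)
  also have "\<dots> \<le> B\<^sup>2 / (2 * B) + B / 2"
    using I' ab B by (intro add_mono divide_right_mono) (auto simp: mult_left_le)
  also have "\<dots> = B" using B by (simp add: power2_eq_square)
  finally show ?thesis .
qed

(* The integrand of H2_sq without the factor sphere_area n; H2_sq integrates it over rdom n. *)
definition H2_density :: "nat \<Rightarrow> (real \<Rightarrow> real) \<Rightarrow> real \<Rightarrow> real" where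
  "H2_density n g r = (if n = 1 then (g r)\<^sup>2 + (deriv g r)\<^sup>2 + (deriv (deriv g) r)\<^sup>2
     else ((g r)\<^sup>2 + (deriv g r)\<^sup>2 + (deriv (deriv g) r)\<^sup>2 + real (n - 1) * (deriv g r / r)\<^sup>2)
            * r ^ (n - 1))"

lemma nn_integral_le_H2_sq:
  assumes "{a..b} \<subseteq> rdom n" "\<And>r. r \<in> {a..b} \<Longrightarrow> h r \<le> H2_density n g r"
  shows "(\<integral>\<^sup>+r. ennreal (h r) * indicator {a..b} r \<partial>lborel) \<le> H2_sq n g"
proof -
  let ?J = "\<integral>\<^sup>+r. ennreal (H2_density n g r) * indicator (rdom n) r \<partial>lborel"
  have "(\<integral>\<^sup>+r. ennreal (h r) * indicator {a..b} r \<partial>lborel) \<le> ?J"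
    using assms by (intro nn_integral_mono) (auto simp: indicator_def subset_iff intro: ennreal_leI)
  also have "?J \<le> H2_sq n g"
  proof (cases "n = 1")
    case True
    then show ?thesis by (simp add: H2_sq_def H2_density_def rdom_def)
  next
    case False
    have "?J = ennreal 1 * ?J" by simp
    also have "\<dots> \<le> ennreal (sphere_area n) * ?J"
      using pi_gt3 by (intro mult_right_mono ennreal_leI) (auto simp: sphere_area_def)
    also have "\<dots> = H2_sq n g"
      using False by (simp add: H2_sq_def H2_density_def rdom_def)
    finally show ?thesis .
  qed
  finally show ?thesis .
qed

lemma sq_plus_deriv_sq_le_H2_density:
  assumes "n = 1 \<or> 1 \<le> r"
  shows "(g r)\<^sup>2 + (deriv g r)\<^sup>2 \<le> H2_density n g r"
proof (cases "n = 1")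
  case False
  let ?s = "(g r)\<^sup>2 + (deriv g r)\<^sup>2 + (deriv (deriv g) r)\<^sup>2 + real (n - 1) * (deriv g r / r)\<^sup>2"
  have "(g r)\<^sup>2 + (deriv g r)\<^sup>2 \<le> ?s" by simp
  also have "?s * 1 \<le> ?s * r ^ (n - 1)"
    using False assms by (intro mult_left_mono) (auto simp: one_le_power)
  finally show ?thesis using False by (simp add: H2_density_def)
qed (simp add: H2_density_def)

lemma deriv_sq_le_H2_density:
  assumes "n \<in> {1, 2, 3}" "r \<in> rdom n"
  shows "(deriv g r)\<^sup>2 \<le> H2_density n g r"
proof (cases "n = 1 \<or> 1 \<le> r")
  case True
  then show ?thesis using sq_plus_deriv_sq_le_H2_density[of n r g] zero_le_power2[of "g r"] by linarith
next
  case False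
  then have r: "0 < r" "r < 1" and n: "n = 2 \<or> n = 3" using assms by (auto simp: rdom_def)
  have "(deriv g r)\<^sup>2 \<le> real (n - 1) * (deriv g r / r)\<^sup>2 * r ^ (n - 1)"
    using n
  proof
    assume "n = 2"
    then have "real (n - 1) * (deriv g r / r)\<^sup>2 * r ^ (n - 1) = (deriv g r)\<^sup>2 / r"
      using r by (simp add: power2_eq_square field_simps)
    also have "(deriv g r)\<^sup>2 \<le> \<dots>" using r by (simp add: le_divide_eq mult_left_le)
    finally show ?thesis .
  next
    assume "n = 3"
    then show ?thesis using r by (simp add: power2_eq_square field_simps)
  qed
  also have "\<dots> \<le> H2_density n g r"
    using False r by (simp add: H2_density_def distrib_right)
  finally show ?thesis .
qed

lemma abs_le_of_H2_sq_le:
  assumes n: "n \<in> {1, 2, 3}" and g: "C2_on (rdom n) g" and H: "H2_sq n g \<le> ennreal (B\<^sup>2)"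
    and B: "0 < B" and x: "x \<in> rdom n"
  shows "\<bar>g x\<bar> \<le> 3 * B"
proof -
  note C1 = C2_on_imp_C1_on[OF g]
  have unit: "\<bar>g y\<bar> \<le> 2 * B" if y: "y \<in> rdom n" "n = 1 \<or> 1 \<le> y" for y
  proof -
    have sub: "{y..y+1} \<subseteq> rdom n" using y by (auto simp: rdom_def)
    have I: "(\<integral>\<^sup>+t. ennreal ((g t)\<^sup>2 + (deriv g t)\<^sup>2) * indicator {y..y+1} t \<partial>lborel) \<le> H2_sq n g"
    proof (rule nn_integral_le_H2_sq[OF sub])
      fix t assume "t \<in> {y..y+1}"
      then have "n = 1 \<or> 1 \<le> t" using y(2) by auto
      then show "(g t)\<^sup>2 + (deriv g t)\<^sup>2 \<le> H2_density n g t" by (rule sq_plus_deriv_sq_le_H2_density)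
    qed
    have "(g y)\<^sup>2 \<le> 2 * B\<^sup>2"
      by (rule sq_le_of_nn_integral_unit_interval[OF C1[OF sub] order_trans[OF I H]])
    also have "\<dots> \<le> (2 * B)\<^sup>2" by (simp add: power2_eq_square)
    finally have "\<bar>g y\<bar> \<le> \<bar>2 * B\<bar>" by (simp only: abs_le_square_iff)
    then show ?thesis using B by simp
  qed
  show ?thesis
  proof (cases "n = 1 \<or> 1 \<le> x")
    case True
    then show ?thesis using unit[OF x True] B by linarith
  next
    case False
    then have "n \<noteq> 1" "x \<le> 1" by auto
    then have rd: "rdom n = {0<..}" by (simp add: rdom_def)
    with x have "0 < x" by simp
    then have sub: "{x..1} \<subseteq> rdom n" unfolding rd by auto
    have I: "(\<integral>\<^sup>+t. ennreal ((deriv g t)\<^sup>2) * indicator {x..1} t \<partial>lborel) \<le> H2_sq n g"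
    proof (rule nn_integral_le_H2_sq[OF sub])
      fix t assume "t \<in> {x..1}"
      then have "t \<in> rdom n" using sub by blast
      then show "(deriv g t)\<^sup>2 \<le> H2_density n g t" by (rule deriv_sq_le_H2_density[OF n])
    qed
    have "1 \<le> x + 1" using \<open>0 < x\<close> by simp
    from abs_diff_le_of_nn_integral_deriv_sq[OF \<open>x \<le> 1\<close> this B C1[OF sub] order_trans[OF I H]]
    have "\<bar>g 1 - g x\<bar> \<le> B" .
    moreover have "\<bar>g 1\<bar> \<le> 2 * B" using unit[of 1] rd by simp
    ultimately show ?thesis by linarith
  qed
qed

lemma abs_le_of_H2_sq_le_square:
  assumes "n \<in> {1, 2, 3}" "C2_on (rdom n) g" "H2_sq n g \<le> ennreal ((C * \<epsilon>\<^sup>2)\<^sup>2)"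
    "0 < \<epsilon>" "x \<in> rdom n"
  shows "\<bar>g x\<bar> \<le> 3 * (\<bar>C\<bar> + 1) * \<epsilon>\<^sup>2"
proof -
  have "\<bar>C * \<epsilon>\<^sup>2\<bar> \<le> \<bar>(\<bar>C\<bar> + 1) * \<epsilon>\<^sup>2\<bar>" by (simp add: abs_mult mult_right_mono)
  then have "(C * \<epsilon>\<^sup>2)\<^sup>2 \<le> ((\<bar>C\<bar> + 1) * \<epsilon>\<^sup>2)\<^sup>2" by (simp only: abs_le_square_iff)
  then have "H2_sq n g \<le> ennreal (((\<bar>C\<bar> + 1) * \<epsilon>\<^sup>2)\<^sup>2)"
    using assms(3) by (meson ennreal_leI order_trans)
  moreover have "0 < (\<bar>C\<bar> + 1) * \<epsilon>\<^sup>2" using assms(4) by (simp add: add_pos_nonneg)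
  ultimately have "\<bar>g x\<bar> \<le> 3 * ((\<bar>C\<bar> + 1) * \<epsilon>\<^sup>2)"
    by (rule abs_le_of_H2_sq_le[OF assms(1,2) _ _ assms(5)])
  then show ?thesis by (simp only: mult.assoc)
qed

section \<open>Boundedness of the ground state\<close>

lemma deriv_le_imp_diff_le:
  fixes f g f' g' :: "real \<Rightarrow> real"
  assumes "a \<le> b" "\<And>s. a \<le> s \<Longrightarrow> s \<le> b \<Longrightarrow> (f has_real_derivative f' s) (at s)"
    "\<And>s. a \<le> s \<Longrightarrow> s \<le> b \<Longrightarrow> (g has_real_derivative g' s) (at s)"
    "\<And>s. a \<le> s \<Longrightarrow> s \<le> b \<Longrightarrow> f' s \<le> g' s"
  shows "f b - f a \<le> g b - g a"
proof -
  have "(\<lambda>s. f s - g s) b \<le> (\<lambda>s. f s - g s) a"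
  proof (rule DERIV_nonpos_imp_nonincreasing[OF assms(1)])
    fix x assume x: "a \<le> x" "x \<le> b"
    show "\<exists>y. DERIV (\<lambda>s. f s - g s) x :> y \<and> y \<le> 0"
      using DERIV_diff[OF assms(2)[OF x] assms(3)[OF x]] assms(4)[OF x] by auto
  qed
  then show ?thesis by simp
qed

definition ode_energy :: "nat \<Rightarrow> real \<Rightarrow> real \<Rightarrow> real" where
  "ode_energy k y z = z\<^sup>2 / 2 - y\<^sup>2 / 2 + y ^ (2 * k + 2) / (2 * real k + 2)"

lemma ode_energy_sublevel_bounded:
  assumes "1 \<le> k"
  obtains M where "\<And>y z. ode_energy k y z \<le> E \<Longrightarrow> \<bar>y\<bar> \<le> M \<and> \<bar>z\<bar> \<le> M"
proof
  fix y z :: real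
  assume E: "ode_energy k y z \<le> E"
  define Y where "Y = max 4 (2 * E)"
  have w0: "0 \<le> y\<^sup>2" by simp
  have "y ^ (2 * k + 2) = y ^ (2 * (k + 1))" by (simp add: algebra_simps)
  also have "\<dots> = (y\<^sup>2) ^ (k + 1)" by (rule power_mult)
  finally have yw: "y ^ (2 * k + 2) = (y\<^sup>2) ^ (k + 1)" .
  have y: "y\<^sup>2 \<le> Y"
  proof (cases "4 \<le> y\<^sup>2")
    case True
    have "1 + real k * (y\<^sup>2 - 1) \<le> (y\<^sup>2) ^ k"
      using Bernoulli_inequality[of "y\<^sup>2 - 1" k] True by simp
    moreover have "real k * 3 \<le> real k * (y\<^sup>2 - 1)" using True by (intro mult_left_mono) auto
    then have "2 * real k + 2 \<le> 1 + real k * (y\<^sup>2 - 1)" using assms by linarith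
    ultimately have "y\<^sup>2 * (2 * real k + 2) \<le> y\<^sup>2 * (y\<^sup>2) ^ k"
      using w0 by (intro mult_left_mono) auto
    then have "y\<^sup>2 \<le> y ^ (2 * k + 2) / (2 * real k + 2)" unfolding yw by (simp add: field_simps)
    then have "y\<^sup>2 \<le> 2 * E" using E zero_le_power2[of z] unfolding ode_energy_def by linarith
    then show ?thesis by (simp add: Y_def)
  qed (simp add: Y_def)
  moreover have "0 \<le> y ^ (2 * k + 2) / (2 * real k + 2)" unfolding yw by simp
  then have "z\<^sup>2 \<le> 2 * E + y\<^sup>2" using E unfolding ode_energy_def by linarith
  ultimately have "y\<^sup>2 \<le> 2 * \<bar>E\<bar> + Y" "z\<^sup>2 \<le> 2 * \<bar>E\<bar> + Y" by linarith+
  then show "\<bar>y\<bar> \<le> sqrt (2 * \<bar>E\<bar> + Y) \<and> \<bar>z\<bar> \<le> sqrt (2 * \<bar>E\<bar> + Y)"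
    by (metis real_sqrt_abs real_sqrt_le_mono)
qed

lemma has_real_derivative_ode_energy:
  fixes y z :: "real \<Rightarrow> real"
  assumes "(y has_real_derivative z t) (at t)"
    "(z has_real_derivative (y t - y t ^ (2 * k + 1) - c * z t)) (at t)"
  shows "((\<lambda>r. ode_energy k (y r) (z r)) has_real_derivative - c * (z t)\<^sup>2) (at t)"
proof -
  note D = DERIV_add[OF DERIV_diff[OF DERIV_cdivide[OF DERIV_power[OF assms(2), of 2], of 2]
        DERIV_cdivide[OF DERIV_power[OF assms(1), of 2], of 2]]
        DERIV_cdivide[OF DERIV_power[OF assms(1), of "2 * k + 2"], of "2 * real k + 2"]]
  show ?thesis
    unfolding ode_energy_def
    by (rule DERIV_cong[OF D]) (simp add: field_simps power2_eq_square)
qed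

lemma ground_state_line_bounded:
  assumes k: "1 \<le> k" and C2: "C2_on UNIV F"
    and ode: "\<And>R. deriv (deriv F) R = F R - F R ^ (2 * k + 1)"
  obtains M where "\<And>R. \<bar>F R\<bar> \<le> M \<and> \<bar>deriv F R\<bar> \<le> M"
proof -
  let ?E = "\<lambda>r. ode_energy k (F r) (deriv F r)"
  have E': "(?E has_real_derivative 0) (at x)" for x
  proof -
    have "(deriv F has_real_derivative F x - F x ^ (2 * k + 1) - 0 * deriv F x) (at x)"
      using C2_on_has_second_derivative[OF C2] ode by simp
    from has_real_derivative_ode_energy[OF C2_on_imp_C1_on(1)[OF C2 order_refl] this]
    show ?thesis by simp
  qed
  have "?E R = ?E 0" for R using DERIV_isconst_all E' by blast
  then show thesis using ode_energy_sublevel_bounded[OF k, of "?E 0"] that by (metis order_refl)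
qed

lemma abs_le_AM_GM:
  fixes x t :: real assumes "t > 0"
  shows "\<bar>x\<bar> \<le> (t * x\<^sup>2 + 1 / t) / 2"
proof -
  have "0 \<le> (t * \<bar>x\<bar> - 1)\<^sup>2" by simp
  then have "2 * t * \<bar>x\<bar> \<le> t\<^sup>2 * x\<^sup>2 + 1" by (simp add: power2_eq_square algebra_simps)
  then show ?thesis using assms by (simp add: field_simps power2_eq_square)
qed

lemma diff_power_le_one:
  fixes x :: real assumes "x > 0" shows "x - x^(2*k+1) \<le> 1"
proof (cases "x \<le> 1")
  case True then show ?thesis using assms zero_le_power[of x "2*k+1"] by linarith
next
  case False
  then have "x^1 \<le> x^(2*k+1)" by (intro power_increasing) auto
  then show ?thesis by simp
qed

lemma has_integral_inverse:
  fixes a b :: real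
  assumes "0 < a" "a \<le> b"
  shows "((\<lambda>s. 1 / s) has_integral ln b - ln a) {a..b}"
proof (rule fundamental_theorem_of_calculus[OF assms(2)])
  fix x assume "x \<in> {a..b}"
  then have "(ln has_real_derivative 1 / x) (at x within {a..b})"
    using assms by (intro DERIV_ln_divide[THEN DERIV_subset]) auto
  then show "(ln has_vector_derivative 1 / x) (at x within {a..b})"
    by (simp add: has_real_derivative_iff_has_vector_derivative)
qed

lemma has_integral_inverse_sq:
  fixes a b :: real
  assumes "0 < a" "a \<le> b"
  shows "((\<lambda>s. 1 / s\<^sup>2) has_integral 1 / a - 1 / b) {a..b}"
proof -
  have "((\<lambda>s. 1 / s\<^sup>2) has_integral (- 1 / b) - (- 1 / a)) {a..b}"
  proof (rule fundamental_theorem_of_calculus[OF assms(2)])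
    fix x assume "x \<in> {a..b}"
    then have "((\<lambda>s. - 1 / s) has_real_derivative 1 / x\<^sup>2) (at x within {a..b})"
      using assms by (auto intro!: derivative_eq_intros simp: power2_eq_square field_simps)
    then show "((\<lambda>s. - 1 / s) has_vector_derivative 1 / x\<^sup>2) (at x within {a..b})"
      by (simp add: has_real_derivative_iff_has_vector_derivative)
  qed
  then show ?thesis by simp
qed

lemma flux_sq_div_le:
  fixes r x y :: real
  assumes "n = 2 \<or> n = 3" "0 < r" "r \<le> 1"
  shows "(r ^ (n - 1) * x)\<^sup>2 / r \<le> (y\<^sup>2 + x\<^sup>2) * r ^ (n - 1)"
proof -
  have "(r ^ (n - 1) * x)\<^sup>2 / r \<le> x\<^sup>2 * r ^ (n - 1)"
    using assms(1)
  proof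
    assume "n = 3"
    then have "(r ^ (n - 1) * x)\<^sup>2 / r = (x\<^sup>2 * r ^ (n - 1)) * r"
      using assms(2) by (simp add: power2_eq_square field_simps)
    also have "\<dots> \<le> x\<^sup>2 * r ^ (n - 1)" using assms(2,3) by (intro mult_left_le) auto
    finally show ?thesis .
  qed (use assms(2) in \<open>simp add: power2_eq_square field_simps\<close>)
  also have "\<dots> \<le> (y\<^sup>2 + x\<^sup>2) * r ^ (n - 1)" using assms(2) by (simp add: distrib_right)
  finally show ?thesis .
qed

(* For n = 3 the integral is 1/r - 1, which forces a = 1/2; then (2k+1) a < 2 is where k = 1 is needed. *)
lemma integral_inverse_power_le:
  assumes n: "n = 2 \<or> n = 3" and k: "1 \<le> k" and k3: "n = 3 \<longrightarrow> k = 1"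
  obtains a A0 where "0 < a" "0 \<le> A0" "real (2*k+1) * a < 2"
    "\<And>r. 0 < r \<Longrightarrow> r \<le> 1 \<Longrightarrow> integral {r..1} (\<lambda>s. 1 / s^(n-1)) \<le> A0 * (r powr (-a))\<^sup>2"
proof -
  define a where "a = (if n = 2 then 1 / (4 * real k + 2) else 1/2)"
  define A0 where "A0 = (if n = 2 then 1 / (2*a) else 1)"
  have a0: "0 < a" using k by (simp add: a_def)
  have A0: "0 \<le> A0" using a0 by (simp add: A0_def)
  have ac: "real (2*k+1) * a < 2"
  proof (cases "n = 2")
    case True
    then have "real (2*k+1) * a = 1/2" using k by (simp add: a_def field_simps)
    then show ?thesis by simp
  next
    case False
    then have "n = 3" using n by simp
    then have "k = 1" using k3 by simp
    then show ?thesis using False by (simp add: a_def)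
  qed
  have ib: "integral {r..1} (\<lambda>s. 1 / s^(n-1)) \<le> A0 * (r powr (-a))\<^sup>2" if r: "0 < r" "r \<le> 1" for r
    using n
  proof
    assume n2: "n = 2"
    have "integral {r..1} (\<lambda>s. 1 / s^(n-1)) = ln (1/r)"
      using has_integral_inverse[OF r] n2 r by (simp add: integral_unique ln_div)
    also have "\<dots> \<le> (1/r) powr (2*a) / (2*a)"
      using r a0 by (intro ln_powr_bound) auto
    also have "(1/r) powr (2*a) = (r powr (-a))\<^sup>2"
      using r by (simp add: powr_divide powr_minus_divide power2_eq_square powr_add[symmetric])
    finally show ?thesis using n2 by (simp add: A0_def)
  next
    assume n3: "n = 3"
    have "integral {r..1} (\<lambda>s. 1 / s^(n-1)) = 1/r - 1"
      using has_integral_inverse_sq[OF r] n3 by (simp add: integral_unique)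
    also have "\<dots> \<le> 1/r" by simp
    also have "1/r = (r powr (-a))\<^sup>2"
      using r n3 by (simp add: a_def power2_eq_square powr_add[symmetric] powr_minus_divide)
    finally show ?thesis using n3 by (simp add: A0_def)
  qed
  show thesis using that a0 A0 ac ib by blast
qed

lemma source_ge_of_power_bound:
  fixes s y D a :: real
  assumes s: "0 < s" and y: "0 < y" "y \<le> D * s powr (-a)" and n: "1 \<le> n"
  shows "- (D ^ (2*k+1) * s powr (real n - real (2*k+1) * a - 1)) \<le> s^(n-1) * (y - y^(2*k+1))"
proof -
  have "(s powr (-a)) ^ (2*k+1) = s powr (- (real (2*k+1) * a))"
    using powr_power[of s "-a" "2*k+1"] s by simp
  then have pw: "(D * s powr (-a))^(2*k+1) = D ^ (2*k+1) * s powr (- (real (2*k+1) * a))"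
    by (simp only: power_mult_distrib)
  have "y^(2*k+1) \<le> D ^ (2*k+1) * s powr (- (real (2*k+1) * a))"
    unfolding pw[symmetric] using y by (intro power_mono) auto
  then have "s^(n-1) * y^(2*k+1) \<le> s^(n-1) * (D ^ (2*k+1) * s powr (- (real (2*k+1) * a)))"
    using s by (intro mult_left_mono) auto
  also have "s^(n-1) * s powr (- (real (2*k+1) * a)) = s powr (real n - real (2*k+1) * a - 1)"
  proof -
    have "s^(n-1) = s powr real (n-1)" using s by (simp add: powr_realpow)
    then have "s^(n-1) * s powr (- (real (2*k+1) * a)) = s powr (real (n-1) - real (2*k+1) * a)"
      by (simp add: powr_diff powr_minus_divide)
    then show ?thesis using n by (simp add: of_nat_diff algebra_simps)
  qed
  then have "s^(n-1) * (D ^ (2*k+1) * s powr (- (real (2*k+1) * a)))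
      = D ^ (2*k+1) * s powr (real n - real (2*k+1) * a - 1)" by (simp add: algebra_simps)
  finally have "s^(n-1) * y^(2*k+1) \<le> D ^ (2*k+1) * s powr (real n - real (2*k+1) * a - 1)" .
  moreover have "0 \<le> s^(n-1) * y" using s y by simp
  ultimately show ?thesis unfolding right_diff_distrib by linarith
qed

definition radial_H1 :: "nat \<Rightarrow> (real \<Rightarrow> real) \<Rightarrow> ennreal" where
  "radial_H1 n F = (\<integral>\<^sup>+ r. ennreal (((F r)\<^sup>2 + (deriv F r)\<^sup>2) * r ^ (n - 1)) * indicator {0<..} r \<partial>lborel)"

context
  fixes n k :: nat and F :: "real \<Rightarrow> real"
  assumes n: "n = 2 \<or> n = 3" and k: "k \<ge> 1" and k3: "n = 3 \<longrightarrow> k = 1"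
    and C2: "C2_on {0<..} F" and pos: "\<And>R. R > 0 \<Longrightarrow> F R > 0"
    and ode: "\<And>R. R > 0 \<Longrightarrow> deriv (deriv F) R = F R - F R ^ (2*k+1) - real (n-1) / R * deriv F R"
    and I1: "radial_H1 n F < \<infinity>"
begin

lemma F_has_derivative: "R > 0 \<Longrightarrow> (F has_real_derivative deriv F R) (at R)"
  using C2_on_imp_C1_on(1)[OF C2 order_refl] by auto

lemma deriv_F_has_derivative:
  "R > 0 \<Longrightarrow> (deriv F has_real_derivative (F R - F R ^ (2*k+1) - real (n-1) / R * deriv F R)) (at R)"
  using C2_on_has_second_derivative[OF C2] ode by fastforce

lemma flux_has_derivative: "R > 0 \<Longrightarrow> ((\<lambda>r. r^(n-1) * deriv F r) has_real_derivative R^(n-1) * (F R - F R^(2*k+1))) (at R)"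
proof -
  assume R: "R > 0"
  from DERIV_mult[OF DERIV_pow[of "n-1"] deriv_F_has_derivative[OF R]]
  show ?thesis
    by (rule DERIV_cong) (use n R in \<open>auto simp: field_simps power2_eq_square\<close>)
qed

lemma radial_H1_finite: obtains c where "radial_H1 n F = ennreal c" "0 \<le> c"
  using I1 by (cases "radial_H1 n F" rule: ennreal_cases) auto

(* Otherwise the weighted H^1 density is at least \<eta>\<^sup>2 / r near the origin, which is not integrable. *)
lemma flux_small_near_origin:
  assumes eta: "\<eta> > 0" and delta: "\<delta> > 0"
  shows "\<exists>\<rho>. 0 < \<rho> \<and> \<rho> < \<delta> \<and> \<bar>\<rho>^(n-1) * deriv F \<rho>\<bar> < \<eta>"
proof (rule ccontr)
  assume "\<not> ?thesis"
  then have H: "\<And>\<rho>. 0 < \<rho> \<Longrightarrow> \<rho> < \<delta> \<Longrightarrow> \<eta> \<le> \<bar>\<rho>^(n-1) * deriv F \<rho>\<bar>" by (meson not_less)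
  obtain c where c: "radial_H1 n F = ennreal c" "0 \<le> c" by (rule radial_H1_finite)
  obtain N :: nat where N: "c / \<eta>\<^sup>2 < real N" using reals_Archimedean2 by blast
  define b where "b = min \<delta> 1 / 2"
  define a where "a = b * exp (- real N)"
  have b: "0 < b" "b < \<delta>" "b \<le> 1" using delta by (auto simp: b_def)
  have a: "0 < a" "a \<le> b" using b by (auto simp: a_def mult_left_le)
  have "((\<lambda>r. \<eta>\<^sup>2 * (1 / r)) has_integral \<eta>\<^sup>2 * (ln b - ln a)) {a..b}"
    by (intro has_integral_mult_right has_integral_inverse a)
  moreover have "ln b - ln a = real N" using a b by (simp add: a_def ln_mult)
  ultimately have "integral {a..b} (\<lambda>r. \<eta>\<^sup>2 / r) = \<eta>\<^sup>2 * real N" by (simp add: integral_unique)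
  then have "ennreal (\<eta>\<^sup>2 * real N) = (\<integral>\<^sup>+ r. ennreal (\<eta>\<^sup>2 / r) * indicator {a..b} r \<partial>lborel)"
    using a by (subst nn_integral_indicator_Icc_eq_integral) (auto intro!: continuous_intros)
  also have "\<dots> \<le> radial_H1 n F" unfolding radial_H1_def
  proof (intro nn_integral_mono)
    fix r
    show "ennreal (\<eta>\<^sup>2 / r) * indicator {a..b} r
      \<le> ennreal (((F r)\<^sup>2 + (deriv F r)\<^sup>2) * r ^ (n - 1)) * indicator {0<..} r"
    proof (cases "r \<in> {a..b}")
      case True
      then have r: "0 < r" "r < \<delta>" "r \<le> 1" using a b by auto
      have "\<eta>\<^sup>2 \<le> \<bar>r^(n-1) * deriv F r\<bar>\<^sup>2" using H[OF r(1,2)] eta by (intro power_mono) auto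
      then have "\<eta>\<^sup>2 / r \<le> (r^(n-1) * deriv F r)\<^sup>2 / r" using r by (simp add: divide_right_mono)
      also have "\<dots> \<le> ((F r)\<^sup>2 + (deriv F r)\<^sup>2) * r ^ (n - 1)" by (rule flux_sq_div_le[OF n r(1,3)])
      finally show ?thesis using True r by (simp add: ennreal_leI indicator_def del: ennreal_plus)
    qed simp
  qed
  finally have "\<eta>\<^sup>2 * real N \<le> c" using c by (simp add: ennreal_le_iff)
  moreover have "c < \<eta>\<^sup>2 * real N" using N eta by (simp add: field_simps)
  ultimately show False by simp
qed

(* The flux has no boundary value at 0; comparing on [\<rho>, r] with \<rho> from flux_small_near_origin replaces it. *)
lemma flux_le_supersolution:
  assumes r: "r > 0" and d: "\<And>s. 0 < s \<Longrightarrow> s \<le> r \<Longrightarrow> (\<psi> has_real_derivative \<psi>' s) (at s)"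
    and le: "\<And>s. 0 < s \<Longrightarrow> s \<le> r \<Longrightarrow> s^(n-1) * (F s - F s^(2*k+1)) \<le> \<psi>' s"
    and nn: "\<And>s. 0 < s \<Longrightarrow> s \<le> r \<Longrightarrow> \<psi> s \<ge> 0"
  shows "r^(n-1) * deriv F r \<le> \<psi> r"
proof (rule field_le_epsilon)
  fix e :: real assume e: "0 < e"
  obtain \<rho> where \<rho>: "0 < \<rho>" "\<rho> < r" "\<bar>\<rho>^(n-1) * deriv F \<rho>\<bar> < e" using flux_small_near_origin[OF e r] by blast
  have "(\<lambda>s. s^(n-1) * deriv F s) r - (\<lambda>s. s^(n-1) * deriv F s) \<rho> \<le> \<psi> r - \<psi> \<rho>"
    by (rule deriv_le_imp_diff_le[of \<rho> r _ "\<lambda>s. s^(n-1) * (F s - F s^(2*k+1))" _ \<psi>'])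
       (use \<rho> flux_has_derivative d le in auto)
  then show "r^(n-1) * deriv F r \<le> \<psi> r + e" using \<rho> nn[of \<rho>] by auto
qed

lemma flux_ge_subsolution:
  assumes r: "r > 0" and d: "\<And>s. 0 < s \<Longrightarrow> s \<le> r \<Longrightarrow> (\<psi> has_real_derivative \<psi>' s) (at s)"
    and le: "\<And>s. 0 < s \<Longrightarrow> s \<le> r \<Longrightarrow> \<psi>' s \<le> s^(n-1) * (F s - F s^(2*k+1))"
    and nn: "\<And>s. 0 < s \<Longrightarrow> s \<le> r \<Longrightarrow> \<psi> s \<le> 0"
  shows "\<psi> r \<le> r^(n-1) * deriv F r"
proof (rule field_le_epsilon)
  fix e :: real assume e: "0 < e"
  obtain \<rho> where \<rho>: "0 < \<rho>" "\<rho> < r" "\<bar>\<rho>^(n-1) * deriv F \<rho>\<bar> < e" using flux_small_near_origin[OF e r] by blast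
  have "\<psi> r - \<psi> \<rho> \<le> (\<lambda>s. s^(n-1) * deriv F s) r - (\<lambda>s. s^(n-1) * deriv F s) \<rho>"
    by (rule deriv_le_imp_diff_le[of \<rho> r _ \<psi>' _ "\<lambda>s. s^(n-1) * (F s - F s^(2*k+1))"])
       (use \<rho> flux_has_derivative d le in auto)
  then show "\<psi> r \<le> r^(n-1) * deriv F r + e" using \<rho> nn[of \<rho>] by auto
qed

lemma deriv_le_one_near_origin:
  assumes r: "0 < r" "r \<le> 1" shows "deriv F r \<le> 1"
proof -
  have "r^(n-1) * deriv F r \<le> (\<lambda>s. s^n) r"
  proof (rule flux_le_supersolution[OF r(1)])
    fix s :: real assume s: "0 < s" "s \<le> r"
    show "((\<lambda>s. s^n) has_real_derivative real n * s^(n - Suc 0)) (at s)" by (rule DERIV_pow)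
    have "s^(n-1) * (F s - F s^(2*k+1)) \<le> s^(n-1) * 1"
      using s pos[of s] diff_power_le_one[of "F s" k] by (intro mult_left_mono) auto
    also have "\<dots> \<le> real n * s^(n - Suc 0)" using n s by auto
    finally show "s^(n-1) * (F s - F s^(2*k+1)) \<le> real n * s^(n - Suc 0)" .
    show "0 \<le> s^n" using s by simp
  qed
  also have "\<dots> = r^(n-1) * r" using n by (auto simp: power2_eq_square power3_eq_cube)
  finally have "deriv F r \<le> r" using r by (simp add: mult_le_cancel_left_pos)
  then show ?thesis using r by simp
qed

lemma deriv_ge_of_power_bound:
  assumes a: "0 \<le> a" and D: "0 \<le> D" and cn: "real (2*k+1) * a < real n"
    and Fb: "\<And>s. 0 < s \<Longrightarrow> s \<le> 1 \<Longrightarrow> F s \<le> D * s powr (-a)"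
    and r: "0 < r" "r \<le> 1"
  shows "- (D^(2*k+1) / (real n - real (2*k+1) * a)) * r powr (1 - real (2*k+1) * a) \<le> deriv F r"
proof -
  define p where "p = real n - real (2*k+1) * a"
  define K where "K = D^(2*k+1)"
  have p: "p > 0" using cn by (simp add: p_def)
  have n1: "real (n - 1) = real n - 1" using n by auto
  have "(\<lambda>s. -(K/p) * s powr p) r \<le> r^(n-1) * deriv F r"
  proof (rule flux_ge_subsolution[OF r(1)])
    fix s :: real assume s: "0 < s" "s \<le> r"
    show "((\<lambda>s. -(K/p) * s powr p) has_real_derivative -(K/p) * (p * s powr (p-1))) (at s)"
      by (intro DERIV_cmult has_real_derivative_powr s(1))
    have "-(K/p) * (p * s powr (p-1)) = - (K * s powr (real n - real (2*k+1) * a - 1))"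
      using p by (simp add: p_def)
    also have "\<dots> \<le> s^(n-1) * (F s - F s^(2*k+1))"
      unfolding K_def using s r n by (intro source_ge_of_power_bound pos Fb) auto
    finally show "-(K/p) * (p * s powr (p-1)) \<le> s^(n-1) * (F s - F s^(2*k+1))" .
    show "-(K/p) * s powr p \<le> 0" using D p by (simp add: K_def)
  qed
  then have A: "-(K/p) * r powr p \<le> r powr real (n-1) * deriv F r"
    using r by (simp add: powr_realpow)
  have rp: "r powr real (n-1) > 0" using r by simp
  have "p - real (n-1) = 1 - real (2*k+1) * a" using n1 by (simp add: p_def)
  then have "r powr (1 - real (2*k+1) * a) = r powr p / r powr real (n-1)" by (metis powr_diff)
  then have "-(K/p) * r powr (1 - real (2*k+1) * a) = (-(K/p) * r powr p) / r powr real (n-1)"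
    by simp
  also have "\<dots> \<le> deriv F r" unfolding pos_divide_le_eq[OF rp] using A by (simp add: mult.commute)
  finally show ?thesis by (simp add: K_def p_def)
qed

lemma le_of_deriv_ge_power:
  assumes q: "q > 0" "K \<ge> 0" and lb: "\<And>s. 0 < s \<Longrightarrow> s \<le> 1 \<Longrightarrow> -K * s powr (q-1) \<le> deriv F s"
    and r: "0 < r" "r \<le> 1"
  shows "F r \<le> F 1 + K / q"
proof -
  have "(\<lambda>s. -(K/q) * s powr q) 1 - (\<lambda>s. -(K/q) * s powr q) r \<le> F 1 - F r"
  proof (rule deriv_le_imp_diff_le[OF r(2)])
    fix s assume s: "r \<le> s" "s \<le> 1"
    then have s0: "0 < s" using r by simp
    show "((\<lambda>s. -(K/q) * s powr q) has_real_derivative -(K/q) * (q * s powr (q-1))) (at s)"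
      by (intro DERIV_cmult has_real_derivative_powr s0)
    show "(F has_real_derivative deriv F s) (at s)" by (rule F_has_derivative[OF s0])
    show "-(K/q) * (q * s powr (q-1)) \<le> deriv F s" using lb[OF s0 s(2)] q by simp
  qed
  moreover have "0 \<le> (K/q) * r powr q" using q by simp
  ultimately show ?thesis by simp
qed

lemma integral_weighted_deriv_sq_le:
  assumes r: "0 < r" "r \<le> 1" and c: "radial_H1 n F = ennreal c" "0 \<le> c"
  shows "integral {r..1} (\<lambda>s. (deriv F s)\<^sup>2 * s^(n-1)) \<le> c"
proof -
  have "continuous_on {r..1} (\<lambda>s. (deriv F s)\<^sup>2 * s^(n-1))"
    using r by (intro continuous_intros C2_on_imp_C1_on(2)[OF C2]) auto
  then have "ennreal (integral {r..1} (\<lambda>s. (deriv F s)\<^sup>2 * s^(n-1)))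
      = (\<integral>\<^sup>+s. ennreal ((deriv F s)\<^sup>2 * s^(n-1)) * indicator {r..1} s \<partial>lborel)"
    by (rule nn_integral_indicator_Icc_eq_integral[symmetric]) (use r in auto)
  also have "\<dots> \<le> radial_H1 n F" unfolding radial_H1_def
  proof (intro nn_integral_mono)
    fix s
    show "ennreal ((deriv F s)\<^sup>2 * s^(n-1)) * indicator {r..1} s
      \<le> ennreal (((F s)\<^sup>2 + (deriv F s)\<^sup>2) * s ^ (n - 1)) * indicator {0<..} s"
    proof (cases "s \<in> {r..1}")
      case True
      then have s: "0 < s" using r by auto
      have "(deriv F s)\<^sup>2 * s^(n-1) \<le> ((F s)\<^sup>2 + (deriv F s)\<^sup>2) * s ^ (n - 1)"
        using s by (simp add: distrib_right)
      then show ?thesis using True s by (simp add: ennreal_leI indicator_def del: ennreal_plus)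
    qed simp
  qed
  finally show ?thesis using c by (simp add: ennreal_le_iff)
qed

(* Cauchy-Schwarz in AM-GM form with a free weight lm: |F'| \<le> (lm F'\<^sup>2 s^(n-1) + s^(1-n) / lm) / 2. *)
lemma le_by_radial_H1:
  assumes r: "0 < r" "r \<le> 1" and lam: "lm > 0" and c: "radial_H1 n F = ennreal c" "0 \<le> c"
  shows "F r \<le> F 1 + (lm * c + integral {r..1} (\<lambda>s. 1 / s^(n-1)) / lm) / 2"
proof -
  have sub: "{r..1} \<subseteq> {0<..}" using r by auto
  have dc: "continuous_on {r..1} (deriv F)" by (rule C2_on_imp_C1_on(2)[OF C2 sub])
  have i1: "(\<lambda>s. (lm/2) * ((deriv F s)\<^sup>2 * s^(n-1))) integrable_on {r..1}"
    by (intro integrable_continuous_interval continuous_intros dc)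
  have i2: "(\<lambda>s. (1/(2*lm)) * (1 / s^(n-1))) integrable_on {r..1}"
    using r by (intro integrable_continuous_interval continuous_intros) auto
  have "F r - F 1 \<le> integral {r..1} (\<lambda>s. \<bar>deriv F s\<bar>)"
    using abs_diff_le_integral_abs_deriv[OF r(2) _ dc] F_has_derivative sub by force
  also have "\<dots> \<le> integral {r..1} (\<lambda>s. (lm/2) * ((deriv F s)\<^sup>2 * s^(n-1)) + (1/(2*lm)) * (1 / s^(n-1)))"
  proof (intro integral_le integrable_add i1 i2 integrable_continuous_interval continuous_intros dc)
    fix s assume s: "s \<in> {r..1}"
    then have sp: "s^(n-1) > 0" using r by simp
    have "\<bar>deriv F s\<bar> \<le> ((lm * s^(n-1)) * (deriv F s)\<^sup>2 + 1 / (lm * s^(n-1))) / 2"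
      using sp lam by (intro abs_le_AM_GM) simp
    also have "\<dots> = (lm/2) * ((deriv F s)\<^sup>2 * s^(n-1)) + (1/(2*lm)) * (1 / s^(n-1))"
      using sp lam by (simp add: field_simps)
    finally show "\<bar>deriv F s\<bar> \<le> (lm/2) * ((deriv F s)\<^sup>2 * s^(n-1)) + (1/(2*lm)) * (1 / s^(n-1))" .
  qed
  also have "\<dots> = (lm/2) * integral {r..1} (\<lambda>s. (deriv F s)\<^sup>2 * s^(n-1))
      + (1/(2*lm)) * integral {r..1} (\<lambda>s. 1 / s^(n-1))"
    by (simp only: integral_add[OF i1 i2] integral_mult_right)
  also have "\<dots> \<le> (lm/2) * c + (1/(2*lm)) * integral {r..1} (\<lambda>s. 1 / s^(n-1))"
    using integral_weighted_deriv_sq_le[OF r c] lam by (intro add_right_mono mult_left_mono) auto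
  also have "\<dots> = (lm * c + integral {r..1} (\<lambda>s. 1 / s^(n-1)) / lm) / 2"
    using lam by (simp add: field_simps)
  finally show ?thesis by linarith
qed

lemma power_bound_near_origin:
  obtains D a where "0 \<le> D" "0 \<le> a" "real (2*k+1) * a < 2"
    "\<And>s. 0 < s \<Longrightarrow> s \<le> 1 \<Longrightarrow> F s \<le> D * s powr (-a)"
proof -
  obtain c where c: "radial_H1 n F = ennreal c" "0 \<le> c" by (rule radial_H1_finite)
  obtain a A0 where a0: "0 < a" and A0: "0 \<le> A0" and ac: "real (2*k+1) * a < 2"
    and ib: "\<And>r. 0 < r \<Longrightarrow> r \<le> 1 \<Longrightarrow> integral {r..1} (\<lambda>s. 1 / s^(n-1)) \<le> A0 * (r powr (-a))\<^sup>2"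
    using integral_inverse_power_le[OF n k k3] by blast
  define D where "D = F 1 + (c + A0) / 2"
  show thesis
  proof (rule that[of D a])
    show "0 \<le> D" using pos[of 1] c A0 by (simp add: D_def)
    show "0 \<le> a" using a0 by simp
    show "real (2*k+1) * a < 2" by (rule ac)
    fix s :: real assume s: "0 < s" "s \<le> 1"
    define y where "y = s powr (-a)"
    have "y = (1/s) powr a" using s by (simp add: y_def powr_divide powr_minus_divide)
    then have y1: "1 \<le> y" using s a0 by (simp add: ge_one_powr_ge_zero)
    have "F s \<le> F 1 + (y * c + integral {s..1} (\<lambda>t. 1 / t^(n-1)) / y) / 2"
      using y1 by (intro le_by_radial_H1 s c) auto
    also have "integral {s..1} (\<lambda>t. 1 / t^(n-1)) / y \<le> A0 * y\<^sup>2 / y"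
      using ib[OF s] y1 by (simp add: y_def divide_right_mono)
    also have "A0 * y\<^sup>2 / y = A0 * y" using y1 by (simp add: power2_eq_square)
    finally have "F s \<le> F 1 + (c + A0) / 2 * y" by (simp add: field_simps)
    also have "F 1 \<le> F 1 * y" using y1 pos[of 1] by (simp add: mult_le_cancel_left1)
    finally show "F s \<le> D * s powr (-a)" by (simp add: D_def y_def algebra_simps)
  qed
qed

(* The lower bound on F' from deriv_ge_of_power_bound is integrable at 0 because (2k+1) a < 2. *)
lemma bounded_above_near_origin:
  obtains M where "0 \<le> M" "\<And>r. 0 < r \<Longrightarrow> r \<le> 1 \<Longrightarrow> F r \<le> M"
proof -
  obtain D a where Da: "0 \<le> D" "0 \<le> a" "real (2*k+1) * a < 2"
    "\<And>s. 0 < s \<Longrightarrow> s \<le> 1 \<Longrightarrow> F s \<le> D * s powr (-a)" using power_bound_near_origin by blast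
  define cc where "cc = real (2*k+1) * a"
  have ccn: "real (2*k+1) * a < real n" using Da(3) n by auto
  define K where "K = D^(2*k+1) / (real n - cc)"
  have K0: "K \<ge> 0" using Da(1) ccn by (simp add: K_def cc_def)
  have q: "2 - cc > 0" using Da(3) by (simp add: cc_def)
  have Fup: "F r \<le> F 1 + K / (2 - cc)" if r: "0 < r" "r \<le> 1" for r
  proof (rule le_of_deriv_ge_power[OF q K0 _ r])
    fix s :: real assume s: "0 < s" "s \<le> 1"
    have "2 - cc - 1 = 1 - real (2*k+1) * a" by (simp add: cc_def)
    then show "-K * s powr (2 - cc - 1) \<le> deriv F s"
      using deriv_ge_of_power_bound[OF Da(2) Da(1) ccn Da(4) s] by (simp add: K_def cc_def)
  qed
  moreover have "0 \<le> F 1 + K / (2 - cc)" using Fup[of 1] pos[of 1] by simp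
  ultimately show thesis using that by blast
qed

lemma bounded_near_origin:
  obtains M where "\<And>r. 0 < r \<Longrightarrow> r \<le> 1 \<Longrightarrow> F r \<le> M \<and> \<bar>deriv F r\<bar> \<le> M"
proof -
  obtain M where M0: "0 \<le> M" and Fup: "\<And>r. 0 < r \<Longrightarrow> r \<le> 1 \<Longrightarrow> F r \<le> M"
    using bounded_above_near_origin by blast
  have lb: "- (M^(2*k+1)) \<le> deriv F r" if r: "0 < r" "r \<le> 1" for r
  proof -
    have "- (M^(2*k+1) / (real n - real (2*k+1) * 0)) * r powr (1 - real (2*k+1) * 0) \<le> deriv F r"
      using n Fup r by (intro deriv_ge_of_power_bound[OF _ M0]) auto
    moreover have "(M^(2*k+1) / real n) * r \<le> M^(2*k+1)"
    proof -
      have "(M^(2*k+1) / real n) * r \<le> (M^(2*k+1) / real n) * 1"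
        using r M0 n by (intro mult_left_mono) auto
      also have "\<dots> \<le> M^(2*k+1)" using M0 n by (auto simp: divide_le_eq)
      finally show ?thesis .
    qed
    ultimately show ?thesis using r by simp
  qed
  show thesis
  proof (rule that[of "max M (max 1 (M^(2*k+1)))"])
    fix r :: real assume r: "0 < r" "r \<le> 1"
    show "F r \<le> max M (max 1 (M^(2*k+1))) \<and> \<bar>deriv F r\<bar> \<le> max M (max 1 (M^(2*k+1)))"
      using Fup[OF r] lb[OF r] deriv_le_one_near_origin[OF r] by auto
  qed
qed

lemma bounded_away_from_origin:
  obtains M where "\<And>r. 1 \<le> r \<Longrightarrow> \<bar>F r\<bar> \<le> M \<and> \<bar>deriv F r\<bar> \<le> M"
proof -
  let ?E = "\<lambda>r. ode_energy k (F r) (deriv F r)"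
  obtain M where M: "\<And>y z. ode_energy k y z \<le> ?E 1 \<Longrightarrow> \<bar>y\<bar> \<le> M \<and> \<bar>z\<bar> \<le> M"
    using ode_energy_sublevel_bounded[OF k] by blast
  have "?E r \<le> ?E 1" if r: "1 \<le> r" for r
  proof (rule DERIV_nonpos_imp_nonincreasing[OF r])
    fix x :: real assume "1 \<le> x"
    then have x: "0 < x" by simp
    show "\<exists>y. (?E has_real_derivative y) (at x) \<and> y \<le> 0"
      using has_real_derivative_ode_energy[OF F_has_derivative[OF x] deriv_F_has_derivative[OF x]] x
      by force
  qed
  then show thesis using M that by blast
qed

lemma radial_ground_state_bounded:
  obtains M where "\<And>r. 0 < r \<Longrightarrow> \<bar>F r\<bar> \<le> M \<and> \<bar>deriv F r\<bar> \<le> M"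
proof -
  obtain M1 where M1: "\<And>r. 0 < r \<Longrightarrow> r \<le> 1 \<Longrightarrow> F r \<le> M1 \<and> \<bar>deriv F r\<bar> \<le> M1" using bounded_near_origin by blast
  obtain M2 where M2: "\<And>r. 1 \<le> r \<Longrightarrow> \<bar>F r\<bar> \<le> M2 \<and> \<bar>deriv F r\<bar> \<le> M2" using bounded_away_from_origin by blast
  show thesis
  proof (rule that[of "max M1 M2"])
    fix r :: real assume r: "0 < r"
    show "\<bar>F r\<bar> \<le> max M1 M2 \<and> \<bar>deriv F r\<bar> \<le> max M1 M2"
    proof (cases "r \<le> 1")
      case True then show ?thesis using M1[OF r True] pos[OF r] by auto
    next
      case False then show ?thesis using M2[of r] by auto
    qed
  qed
qed

end

lemma ground_state_bounded:
  assumes n: "n \<in> {1, 2, 3}" and k: "1 \<le> k" and k3: "n = 3 \<longrightarrow> k = 1"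
    and C2: "C2_on (rdom n) F" and pos: "\<forall>R\<in>rdom n. F R > 0"
    and eq: "\<forall>R\<in>rdom n. - (deriv (deriv F) R + real (n - 1) / R * deriv F R) - F R ^ (2 * k + 1) = - F R"
    and H1: "H1_sq n F < \<infinity>"
  obtains M where "\<And>R. R \<in> rdom n \<Longrightarrow> \<bar>F R\<bar> \<le> M \<and> \<bar>deriv F R\<bar> \<le> M"
proof (cases "n = 1")
  case True
  then have "rdom n = UNIV" by (simp add: rdom_def)
  then show thesis
    using ground_state_line_bounded[OF k, of F] C2 eq True that by (auto simp: algebra_simps)
next
  case False
  then have n23: "n = 2 \<or> n = 3" and rd: "rdom n = {0<..}" using n by (auto simp: rdom_def)
  have "ennreal (sphere_area n) * radial_H1 n F < \<infinity>"
    using H1 False by (simp add: H1_sq_def radial_H1_def)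
  then have "radial_H1 n F < \<infinity>"
    by (auto simp: sphere_area_def ennreal_mult_less_top top.not_eq_extremum split: if_splits)
  moreover have "deriv (deriv F) R = F R - F R ^ (2 * k + 1) - real (n - 1) / R * deriv F R"
    if "0 < R" for R using eq that rd by (auto simp: algebra_simps)
  ultimately show thesis
    using radial_ground_state_bounded[OF n23 k k3] C2 pos rd that by auto
qed

section \<open>The entries of the remainder matrix\<close>

lemma abs_power_diff_le:
  fixes x y M :: real
  assumes "\<bar>x\<bar> \<le> M" "\<bar>y\<bar> \<le> M" "0 < M"
  shows "\<bar>x ^ j - y ^ j\<bar> \<le> real j * M ^ (j - 1) * \<bar>x - y\<bar>"
proof (cases j)
  case (Suc i)
  have "\<bar>(x / M) ^ j - (y / M) ^ j\<bar> \<le> real j * \<bar>x / M - y / M\<bar>"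
    using assms norm_power_diff[of "x / M" "y / M" j] by simp
  then have "M ^ j * \<bar>(x / M) ^ j - (y / M) ^ j\<bar> \<le> M ^ j * (real j * (\<bar>x - y\<bar> / M))"
    using assms(3) by (intro mult_left_mono) (auto simp: diff_divide_distrib[symmetric])
  moreover have "M ^ j * \<bar>(x / M) ^ j - (y / M) ^ j\<bar> = \<bar>x ^ j - y ^ j\<bar>"
    using assms(3) by (simp add: power_divide abs_mult diff_divide_distrib[symmetric])
  moreover have "M ^ j * (real j * (\<bar>x - y\<bar> / M)) = real j * M ^ (j - 1) * \<bar>x - y\<bar>"
    using assms(3) by (simp add: Suc)
  ultimately show ?thesis by simp
qed simp

lemma sqrt_sq_diff_bounds:
  fixes m \<epsilon> :: real
  assumes "0 < \<epsilon>" "\<epsilon> < m"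
  defines "\<omega> \<equiv> sqrt (m\<^sup>2 - \<epsilon>\<^sup>2)"
  shows "0 \<le> m - \<omega>" "m - \<omega> \<le> \<epsilon>\<^sup>2 / m" "\<bar>1 / (2 * m) - (m - \<omega>) / \<epsilon>\<^sup>2\<bar> \<le> \<epsilon>\<^sup>2 / (2 * m ^ 3)"
proof -
  have "\<epsilon>\<^sup>2 \<le> m\<^sup>2" using assms by (intro power_mono) auto
  then have \<omega>: "0 \<le> \<omega>" "\<omega>\<^sup>2 = m\<^sup>2 - \<epsilon>\<^sup>2" by (simp_all add: \<omega>_def)
  have "(m - \<omega>) * (m + \<omega>) = \<epsilon>\<^sup>2"
    using \<omega> by (simp add: algebra_simps power2_eq_square)
  moreover have "0 < m + \<omega>" using \<omega> assms(1,2) by linarith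
  ultimately have "m - \<omega> = \<epsilon>\<^sup>2 / (m + \<omega>)"
    by (simp add: eq_divide_eq)
  then have ratio: "(m - \<omega>) / \<epsilon>\<^sup>2 = 1 / (m + \<omega>)" using assms by simp
  show "0 \<le> m - \<omega>" using \<open>m - \<omega> = _\<close> \<open>0 < m + \<omega>\<close> by simp
  show "m - \<omega> \<le> \<epsilon>\<^sup>2 / m"
    using \<open>m - \<omega> = _\<close> \<omega> assms(1,2) by (simp add: frac_le)
  have "1 / (2 * m) - (m - \<omega>) / \<epsilon>\<^sup>2 = - ((m - \<omega>) / (2 * m * (m + \<omega>)))"
    unfolding ratio using \<open>0 < m + \<omega>\<close> assms(1,2) by (simp add: field_simps minus_divide_left)
  then have "\<bar>1 / (2 * m) - (m - \<omega>) / \<epsilon>\<^sup>2\<bar> = (m - \<omega>) / (2 * m * (m + \<omega>))"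
    using \<open>0 < m + \<omega>\<close> \<open>0 \<le> m - \<omega>\<close> assms(1,2) by simp
  also have "\<dots> = \<epsilon>\<^sup>2 / (2 * m * (m + \<omega>)\<^sup>2)"
    using \<open>m - \<omega> = _\<close> by (simp add: power2_eq_square)
  also have "\<dots> \<le> \<epsilon>\<^sup>2 / (2 * m * m\<^sup>2)"
    using \<omega> assms(1,2) by (intro divide_left_mono mult_left_mono power_mono mult_pos_pos) auto
  finally show "\<bar>1 / (2 * m) - (m - \<omega>) / \<epsilon>\<^sup>2\<bar> \<le> \<epsilon>\<^sup>2 / (2 * m ^ 3)"
    by (simp add: power2_eq_square power3_eq_cube)
qed

lemma scaled_nonlinearity:
  fixes e \<epsilon> V U :: real
  assumes "e ^ k = \<epsilon>" "1 \<le> k"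
  defines "P \<equiv> V\<^sup>2 - \<epsilon>\<^sup>2 * U\<^sup>2"
  shows "((e * V)\<^sup>2 - (\<epsilon> * e * U)\<^sup>2) ^ k = \<epsilon>\<^sup>2 * P ^ k"
    and "((e * V)\<^sup>2 - (\<epsilon> * e * U)\<^sup>2) ^ (k - 1) * (e * V)\<^sup>2 = \<epsilon>\<^sup>2 * (P ^ (k - 1) * V\<^sup>2)"
    and "((e * V)\<^sup>2 - (\<epsilon> * e * U)\<^sup>2) ^ (k - 1) * (e * V) * (\<epsilon> * e * U)
           = \<epsilon> ^ 3 * (P ^ (k - 1) * (V * U))"
    and "((e * V)\<^sup>2 - (\<epsilon> * e * U)\<^sup>2) ^ (k - 1) * (\<epsilon> * e * U)\<^sup>2 = \<epsilon> ^ 4 * (P ^ (k - 1) * U\<^sup>2)"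
proof -
  have diff: "(e * V)\<^sup>2 - (\<epsilon> * e * U)\<^sup>2 = e\<^sup>2 * P"
    by (simp add: P_def power_mult_distrib algebra_simps)
  have ek: "(e\<^sup>2) ^ k = \<epsilon>\<^sup>2"
    using assms(1) by (metis power_mult power_mult_distrib mult.commute)
  have ek1: "(e\<^sup>2) ^ (k - 1) * e\<^sup>2 = \<epsilon>\<^sup>2"
    using ek assms(2) by (metis Suc_diff_le diff_Suc_1 power_Suc2)
  show "((e * V)\<^sup>2 - (\<epsilon> * e * U)\<^sup>2) ^ k = \<epsilon>\<^sup>2 * P ^ k"
    unfolding diff by (simp add: power_mult_distrib ek)
  show "((e * V)\<^sup>2 - (\<epsilon> * e * U)\<^sup>2) ^ (k - 1) * (e * V)\<^sup>2 = \<epsilon>\<^sup>2 * (P ^ (k - 1) * V\<^sup>2)"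
    unfolding diff by (simp add: power_mult_distrib ek1[symmetric] algebra_simps)
  show "((e * V)\<^sup>2 - (\<epsilon> * e * U)\<^sup>2) ^ (k - 1) * (e * V) * (\<epsilon> * e * U)
           = \<epsilon> ^ 3 * (P ^ (k - 1) * (V * U))"
  proof -
    have "((e * V)\<^sup>2 - (\<epsilon> * e * U)\<^sup>2) ^ (k - 1) * (e * V) * (\<epsilon> * e * U)
        = ((e\<^sup>2) ^ (k - 1) * e\<^sup>2) * (\<epsilon> * (P ^ (k - 1) * (V * U)))"
      unfolding diff by (simp add: power_mult_distrib power2_eq_square algebra_simps)
    also have "\<dots> = \<epsilon> ^ 3 * (P ^ (k - 1) * (V * U))"
      unfolding ek1 by (simp add: power3_eq_cube power2_eq_square)
    finally show ?thesis .
  qed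
  show "((e * V)\<^sup>2 - (\<epsilon> * e * U)\<^sup>2) ^ (k - 1) * (\<epsilon> * e * U)\<^sup>2 = \<epsilon> ^ 4 * (P ^ (k - 1) * U\<^sup>2)"
  proof -
    have "((e * V)\<^sup>2 - (\<epsilon> * e * U)\<^sup>2) ^ (k - 1) * (\<epsilon> * e * U)\<^sup>2
        = ((e\<^sup>2) ^ (k - 1) * e\<^sup>2) * (\<epsilon>\<^sup>2 * (P ^ (k - 1) * U\<^sup>2))"
      unfolding diff by (simp add: power_mult_distrib power2_eq_square algebra_simps)
    also have "\<dots> = \<epsilon> ^ 4 * (P ^ (k - 1) * U\<^sup>2)"
      unfolding ek1 by (simp flip: power_add)
    finally show ?thesis .
  qed
qed

lemma W_entries_eq:
  fixes m \<omega> \<epsilon> e V U Vh P vv uu :: real and k :: nat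
  defines "\<delta> \<equiv> 1 / (2 * m) - (m - \<omega>) / \<epsilon>\<^sup>2"
  assumes P_def: "P = V\<^sup>2 - \<epsilon>\<^sup>2 * U\<^sup>2" and vv_def: "vv = e * V" and uu_def: "uu = \<epsilon> * e * U"
    and \<epsilon>: "0 < \<epsilon>" and k: "1 \<le> k" and e: "e ^ k = \<epsilon>"
  shows "1 / (2 * m) - Vh ^ (2 * k) - (m - \<omega> - (vv\<^sup>2 - uu\<^sup>2) ^ k) / \<epsilon>\<^sup>2 = \<delta> + (P ^ k - Vh ^ (2 * k))"
    and "\<omega> - m - (vv\<^sup>2 - uu\<^sup>2) ^ k = - (m - \<omega>) - \<epsilon>\<^sup>2 * P ^ k"
    and "- 1 / (2 * m) + (2 * real k + 1) * Vh ^ (2 * k)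
          - (\<omega> - m + (vv\<^sup>2 - uu\<^sup>2) ^ k + 2 * (real k * (vv\<^sup>2 - uu\<^sup>2) ^ (k - 1)) * vv\<^sup>2) / \<epsilon>\<^sup>2
        = - \<delta> - (2 * real k + 1) * (P ^ k - Vh ^ (2 * k)) - 2 * real k * \<epsilon>\<^sup>2 * (P ^ (k - 1) * U\<^sup>2)"
    and "2 * (real k * (vv\<^sup>2 - uu\<^sup>2) ^ (k - 1)) * vv * uu / \<epsilon>
        = 2 * real k * \<epsilon>\<^sup>2 * (P ^ (k - 1) * (V * U))"
    and "m - \<omega> + (vv\<^sup>2 - uu\<^sup>2) ^ k - 2 * (real k * (vv\<^sup>2 - uu\<^sup>2) ^ (k - 1)) * uu\<^sup>2
        = (m - \<omega>) + \<epsilon>\<^sup>2 * P ^ k - 2 * real k * \<epsilon>\<^sup>2 * (P ^ (k - 1) * (\<epsilon>\<^sup>2 * U\<^sup>2))"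
proof -
  note scaled = scaled_nonlinearity[OF e k, of V U, folded P_def vv_def uu_def]
  have V2: "P ^ (k - 1) * V\<^sup>2 = P ^ k + \<epsilon>\<^sup>2 * (P ^ (k - 1) * U\<^sup>2)"
  proof -
    have "P ^ (k - 1) * P = P ^ k" using k by (metis Suc_diff_le diff_Suc_1 power_Suc2)
    then show ?thesis by (simp add: P_def algebra_simps)
  qed
  have f'v: "2 * (real k * (vv\<^sup>2 - uu\<^sup>2) ^ (k - 1)) * vv\<^sup>2 = 2 * real k * \<epsilon>\<^sup>2 * (P ^ (k - 1) * V\<^sup>2)"
    by (simp only: mult.assoc scaled(2))
  have "2 * (real k * (vv\<^sup>2 - uu\<^sup>2) ^ (k - 1)) * uu\<^sup>2 = 2 * real k * \<epsilon> ^ 4 * (P ^ (k - 1) * U\<^sup>2)"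
    by (simp only: mult.assoc scaled(4))
  then have f'u: "2 * (real k * (vv\<^sup>2 - uu\<^sup>2) ^ (k - 1)) * uu\<^sup>2
      = 2 * real k * \<epsilon>\<^sup>2 * (P ^ (k - 1) * (\<epsilon>\<^sup>2 * U\<^sup>2))"
    by (simp add: power4_eq_xxxx power2_eq_square algebra_simps)
  show "1 / (2 * m) - Vh ^ (2 * k) - (m - \<omega> - (vv\<^sup>2 - uu\<^sup>2) ^ k) / \<epsilon>\<^sup>2 = \<delta> + (P ^ k - Vh ^ (2 * k))"
    using \<epsilon> by (simp add: scaled \<delta>_def diff_divide_distrib)
  show "\<omega> - m - (vv\<^sup>2 - uu\<^sup>2) ^ k = - (m - \<omega>) - \<epsilon>\<^sup>2 * P ^ k" by (simp add: scaled)
  show "- 1 / (2 * m) + (2 * real k + 1) * Vh ^ (2 * k)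
          - (\<omega> - m + (vv\<^sup>2 - uu\<^sup>2) ^ k + 2 * (real k * (vv\<^sup>2 - uu\<^sup>2) ^ (k - 1)) * vv\<^sup>2) / \<epsilon>\<^sup>2
        = - \<delta> - (2 * real k + 1) * (P ^ k - Vh ^ (2 * k)) - 2 * real k * \<epsilon>\<^sup>2 * (P ^ (k - 1) * U\<^sup>2)"
    unfolding f'v scaled(1) V2 using \<epsilon>
    by (simp add: \<delta>_def add_divide_distrib diff_divide_distrib power4_eq_xxxx power2_eq_square
        algebra_simps)
  show "2 * (real k * (vv\<^sup>2 - uu\<^sup>2) ^ (k - 1)) * vv * uu / \<epsilon>
        = 2 * real k * \<epsilon>\<^sup>2 * (P ^ (k - 1) * (V * U))"
    using scaled(3) \<epsilon> by (simp add: power2_eq_square power3_eq_cube field_simps)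
  show "m - \<omega> + (vv\<^sup>2 - uu\<^sup>2) ^ k - 2 * (real k * (vv\<^sup>2 - uu\<^sup>2) ^ (k - 1)) * uu\<^sup>2
        = (m - \<omega>) + \<epsilon>\<^sup>2 * P ^ k - 2 * real k * \<epsilon>\<^sup>2 * (P ^ (k - 1) * (\<epsilon>\<^sup>2 * U\<^sup>2))"
    unfolding f'u scaled(1) by simp
qed

definition W_bound :: "real \<Rightarrow> nat \<Rightarrow> real \<Rightarrow> real" where
  "W_bound m k M = 1 / (2 * m ^ 3) + 1 / m + (2 * real k + 3) * (real k * M ^ (k + 1))"

lemma W_entries_le:
  fixes m \<epsilon> e V U Vh M :: real and k :: nat
  defines "P \<equiv> V\<^sup>2 - \<epsilon>\<^sup>2 * U\<^sup>2" and "vv \<equiv> e * V" and "uu \<equiv> \<epsilon> * e * U"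
    and "\<omega> \<equiv> sqrt (m\<^sup>2 - \<epsilon>\<^sup>2)" and "c \<equiv> W_bound m k M * \<epsilon>\<^sup>2"
  assumes m: "0 < m" and k: "1 \<le> k" and \<epsilon>: "0 < \<epsilon>" "\<epsilon> \<le> 1" "\<epsilon> < m" and e: "e ^ k = \<epsilon>"
    and M: "1 \<le> M" "\<bar>P\<bar> \<le> M" "\<bar>V * U\<bar> \<le> M" "U\<^sup>2 \<le> M"
    and P_Vh: "\<bar>P ^ k - Vh ^ (2 * k)\<bar> \<le> real k * M ^ k * \<epsilon>\<^sup>2"
  shows "\<bar>1 / (2 * m) - Vh ^ (2 * k) - (m - \<omega> - (vv\<^sup>2 - uu\<^sup>2) ^ k) / \<epsilon>\<^sup>2\<bar> \<le> c"
    and "\<bar>\<omega> - m - (vv\<^sup>2 - uu\<^sup>2) ^ k\<bar> \<le> c"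
    and "\<bar>- 1 / (2 * m) + (2 * real k + 1) * Vh ^ (2 * k)
          - (\<omega> - m + (vv\<^sup>2 - uu\<^sup>2) ^ k + 2 * (real k * (vv\<^sup>2 - uu\<^sup>2) ^ (k - 1)) * vv\<^sup>2) / \<epsilon>\<^sup>2\<bar> \<le> c"
    and "\<bar>2 * (real k * (vv\<^sup>2 - uu\<^sup>2) ^ (k - 1)) * vv * uu / \<epsilon>\<bar> \<le> c"
    and "\<bar>m - \<omega> + (vv\<^sup>2 - uu\<^sup>2) ^ k - 2 * (real k * (vv\<^sup>2 - uu\<^sup>2) ^ (k - 1)) * uu\<^sup>2\<bar> \<le> c"
proof -
  note eqs = W_entries_eq[OF P_def[THEN meta_eq_to_obj_eq] vv_def[THEN meta_eq_to_obj_eq]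
      uu_def[THEN meta_eq_to_obj_eq] \<epsilon>(1) k e]
  define X where "X = real k * M ^ (k + 1) * \<epsilon>\<^sup>2"
  have \<epsilon>2: "0 < \<epsilon>\<^sup>2" "\<epsilon>\<^sup>2 \<le> 1" using \<epsilon> by (simp_all add: power_le_one)
  have \<delta>: "\<bar>1 / (2 * m) - (m - \<omega>) / \<epsilon>\<^sup>2\<bar> \<le> \<epsilon>\<^sup>2 / (2 * m ^ 3)" and m_\<omega>: "0 \<le> m - \<omega>" "m - \<omega> \<le> \<epsilon>\<^sup>2 / m"
    using sqrt_sq_diff_bounds[OF \<epsilon>(1,3)] by (simp_all add: \<omega>_def)
  have Pk: "\<bar>P ^ k\<bar> \<le> M ^ k" and Pk1: "\<bar>P ^ (k - 1)\<bar> \<le> M ^ k"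
    using M power_increasing[of "k - 1" k M] power_mono[OF M(2), of "k - 1"]
    by (auto simp: power_abs intro: power_mono)
  have kMk: "real k * M ^ k \<le> real k * M ^ (k + 1)"
    using M(1) by (intro mult_left_mono power_increasing) auto
  moreover have "M ^ k \<le> real k * M ^ k"
    using k one_le_power[OF M(1), of k] mult_right_mono[of 1 "real k" "M ^ k"] by simp
  ultimately have "M ^ k \<le> real k * M ^ (k + 1)" by linarith
  with kMk have X: "M ^ k * \<epsilon>\<^sup>2 \<le> X" "real k * M ^ k * \<epsilon>\<^sup>2 \<le> X"
    using \<epsilon>2 unfolding X_def by (auto intro: mult_right_mono)
  moreover have "0 \<le> M ^ k * \<epsilon>\<^sup>2" using M(1) by simp
  ultimately have "0 \<le> X" by linarith
  have c: "c = \<epsilon>\<^sup>2 / (2 * m ^ 3) + \<epsilon>\<^sup>2 / m + (2 * real k + 3) * X"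
    by (simp add: c_def W_bound_def X_def algebra_simps)
  have "\<bar>\<epsilon>\<^sup>2 * P ^ k\<bar> \<le> M ^ k * \<epsilon>\<^sup>2"
    using Pk \<epsilon>2 by (simp add: abs_mult mult.commute mult_left_mono)
  then have "\<bar>\<epsilon>\<^sup>2 * P ^ k\<bar> \<le> X" "\<bar>P ^ k - Vh ^ (2 * k)\<bar> \<le> X"
    using X P_Vh by linarith+
  moreover have "\<bar>(2 * real k + 1) * (P ^ k - Vh ^ (2 * k))\<bar> \<le> (2 * real k + 1) * X"
    using \<open>\<bar>P ^ k - Vh ^ (2 * k)\<bar> \<le> X\<close> by (simp add: abs_mult mult_left_mono)
  moreover have S: "\<bar>2 * real k * \<epsilon>\<^sup>2 * (P ^ (k - 1) * W)\<bar> \<le> 2 * X" if "\<bar>W\<bar> \<le> M" for W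
  proof -
    have "\<bar>P ^ (k - 1) * W\<bar> \<le> M ^ k * M" unfolding abs_mult using Pk1 that by (intro mult_mono) auto
    then have "2 * real k * \<epsilon>\<^sup>2 * \<bar>P ^ (k - 1) * W\<bar> \<le> 2 * real k * \<epsilon>\<^sup>2 * (M ^ k * M)"
      using \<epsilon>2 by (simp add: mult_left_mono)
    then show ?thesis using \<epsilon>2 by (simp add: X_def abs_mult algebra_simps)
  qed
  moreover have "\<bar>U\<^sup>2\<bar> \<le> M" "\<bar>\<epsilon>\<^sup>2 * U\<^sup>2\<bar> \<le> M"
    using M(4) \<epsilon>2 by (auto simp: abs_mult intro: order_trans[OF mult_left_le_one_le])
  ultimately have bounds: "\<bar>\<epsilon>\<^sup>2 * P ^ k\<bar> \<le> X" "\<bar>P ^ k - Vh ^ (2 * k)\<bar> \<le> X"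
    "\<bar>(2 * real k + 1) * (P ^ k - Vh ^ (2 * k))\<bar> \<le> (2 * real k + 1) * X"
    "\<bar>2 * real k * \<epsilon>\<^sup>2 * (P ^ (k - 1) * U\<^sup>2)\<bar> \<le> 2 * X"
    "\<bar>2 * real k * \<epsilon>\<^sup>2 * (P ^ (k - 1) * (V * U))\<bar> \<le> 2 * X"
    "\<bar>2 * real k * \<epsilon>\<^sup>2 * (P ^ (k - 1) * (\<epsilon>\<^sup>2 * U\<^sup>2))\<bar> \<le> 2 * X"
    using M(3) by blast+
  have "0 \<le> \<epsilon>\<^sup>2 / (2 * m ^ 3)" "0 \<le> \<epsilon>\<^sup>2 / m" "3 * X \<le> (2 * real k + 3) * X"
    "(2 * real k + 1) * X + 2 * X = (2 * real k + 3) * X"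
    using m mult_right_mono[of 3 "2 * real k + 3" X] \<open>0 \<le> X\<close> by (auto simp: algebra_simps)
  note facts = this bounds \<delta> m_\<omega>
  show "\<bar>1 / (2 * m) - Vh ^ (2 * k) - (m - \<omega> - (vv\<^sup>2 - uu\<^sup>2) ^ k) / \<epsilon>\<^sup>2\<bar> \<le> c"
    using facts unfolding eqs(1) c abs_le_iff by (intro conjI; linarith)
  show "\<bar>\<omega> - m - (vv\<^sup>2 - uu\<^sup>2) ^ k\<bar> \<le> c"
    using facts unfolding eqs(2) c abs_le_iff by (intro conjI; linarith)
  show "\<bar>- 1 / (2 * m) + (2 * real k + 1) * Vh ^ (2 * k)
          - (\<omega> - m + (vv\<^sup>2 - uu\<^sup>2) ^ k + 2 * (real k * (vv\<^sup>2 - uu\<^sup>2) ^ (k - 1)) * vv\<^sup>2) / \<epsilon>\<^sup>2\<bar> \<le> c"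
    using facts unfolding eqs(3) c abs_le_iff by (intro conjI; linarith)
  show "\<bar>2 * (real k * (vv\<^sup>2 - uu\<^sup>2) ^ (k - 1)) * vv * uu / \<epsilon>\<bar> \<le> c"
    using facts unfolding eqs(4) c abs_le_iff by (intro conjI; linarith)
  show "\<bar>m - \<omega> + (vv\<^sup>2 - uu\<^sup>2) ^ k - 2 * (real k * (vv\<^sup>2 - uu\<^sup>2) ^ (k - 1)) * uu\<^sup>2\<bar> \<le> c"
    using facts unfolding eqs(5) c abs_le_iff by (intro conjI; linarith)
qed

lemma abs_hat_profile_le:
  fixes m M R :: real and k :: nat
  assumes "0 < m" "\<bar>F R\<bar> \<le> M" "\<bar>deriv F R\<bar> \<le> M"
  defines "A \<equiv> M * ((2 * m) powr (- 1 / (2 * real k)) + (2 * m) powr (- 1 / (2 * real k) - 1))"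
  shows "\<bar>Vhat m k F R\<bar> \<le> A" "\<bar>Uhat m k F R\<bar> \<le> A"
proof -
  have "0 \<le> M" using assms(2) by linarith
  then show "\<bar>Vhat m k F R\<bar> \<le> A" "\<bar>Uhat m k F R\<bar> \<le> A"
    using assms(1-3) unfolding A_def Vhat_def Uhat_def abs_mult abs_minus_cancel
    by (simp_all add: distrib_left mult.commute add_increasing2 add_increasing mult_mono)
qed

lemma mat_opnorm_W_mat_le:
  fixes m \<epsilon> e A K Vt Ut R :: real and k :: nat
  assumes m: "0 < m" and k: "1 \<le> k" and \<epsilon>: "0 < \<epsilon>" "\<epsilon> \<le> 1" "\<epsilon> < m" and e: "e ^ k = \<epsilon>"
    and A: "\<bar>Vhat m k F R\<bar> \<le> A" "\<bar>Uhat m k F R\<bar> \<le> A"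
    and K: "\<bar>Vt\<bar> \<le> K * \<epsilon>\<^sup>2" "\<bar>Ut\<bar> \<le> K * \<epsilon>\<^sup>2"
    and v: "v (R / \<epsilon>) = e * (Vhat m k F R + Vt)"
    and u: "u (R / \<epsilon>) = \<epsilon> * e * (Uhat m k F R + Ut)"
  shows "mat_opnorm (W_mat m k F v u \<epsilon> R) \<le> 16 * (W_bound m k (2 * (A + K)\<^sup>2 + 1) * \<epsilon>\<^sup>2)"
proof -
  define Vh Uh where "Vh = Vhat m k F R" and "Uh = Uhat m k F R"
  define V U where "V = Vh + Vt" and "U = Uh + Ut"
  define B M where "B = A + K" and "M = 2 * B\<^sup>2 + 1"
  define P where "P = V\<^sup>2 - \<epsilon>\<^sup>2 * U\<^sup>2"
  have \<epsilon>2: "0 < \<epsilon>\<^sup>2" "\<epsilon>\<^sup>2 \<le> 1" using \<epsilon> by (simp_all add: power_le_one)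
  have K0: "0 \<le> K" using K(1) \<epsilon>2 by (meson abs_ge_zero order_trans zero_le_mult_iff not_le)
  have "K * \<epsilon>\<^sup>2 \<le> K" using K0 \<epsilon>2 by (simp add: mult_right_le_one_le)
  then have Kt: "\<bar>Vt\<bar> \<le> K" "\<bar>Ut\<bar> \<le> K" using K by linarith+
  have "\<bar>V\<bar> \<le> B" "\<bar>U\<bar> \<le> B" "\<bar>Vh\<bar> \<le> B"
    using A Kt K0 by (auto simp: V_def U_def B_def Vh_def Uh_def intro: abs_triangle_ineq[THEN order_trans])
  moreover have "x\<^sup>2 \<le> B\<^sup>2" if "\<bar>x\<bar> \<le> B" for x :: real
    by (metis abs_ge_zero power2_abs power_mono that)
  ultimately have sq: "V\<^sup>2 \<le> B\<^sup>2" "U\<^sup>2 \<le> B\<^sup>2" "Vh\<^sup>2 \<le> B\<^sup>2" "\<bar>V * U\<bar> \<le> B\<^sup>2"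
    by (auto simp: power2_eq_square abs_mult intro: mult_mono)
  have \<epsilon>U: "\<epsilon>\<^sup>2 * U\<^sup>2 \<le> B\<^sup>2" using sq(2) \<epsilon>2 by (meson mult_left_le_one_le order_trans zero_le_power2)
  have "\<bar>P\<bar> \<le> M"
    using sq(1) \<epsilon>U zero_le_power2[of V] mult_nonneg_nonneg[OF zero_le_power2 zero_le_power2, of \<epsilon> U]
    unfolding P_def M_def abs_le_iff by (intro conjI; linarith)
  then have M: "1 \<le> M" "\<bar>P\<bar> \<le> M" "\<bar>V * U\<bar> \<le> M" "U\<^sup>2 \<le> M" "\<bar>Vh\<^sup>2\<bar> \<le> M"
    using sq by (auto simp: M_def)
  have "\<bar>P - Vh\<^sup>2\<bar> \<le> M * \<epsilon>\<^sup>2"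
  proof -
    have "\<bar>V\<^sup>2 - Vh\<^sup>2\<bar> = \<bar>Vt\<bar> * \<bar>2 * Vh + Vt\<bar>"
      by (simp add: V_def power2_eq_square algebra_simps flip: abs_mult)
    also have "\<dots> \<le> (K * \<epsilon>\<^sup>2) * (2 * A + K)"
      using K(1) A(1) Kt by (intro mult_mono) (auto simp: Vh_def intro: abs_triangle_ineq[THEN order_trans])
    also have "\<dots> = (K * (2 * A + K)) * \<epsilon>\<^sup>2" by (simp add: algebra_simps)
    also have "\<dots> \<le> B\<^sup>2 * \<epsilon>\<^sup>2"
      by (rule mult_right_mono) (simp_all add: B_def power2_eq_square algebra_simps)
    finally have "\<bar>V\<^sup>2 - Vh\<^sup>2\<bar> \<le> B\<^sup>2 * \<epsilon>\<^sup>2" .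
    moreover have "\<epsilon>\<^sup>2 * U\<^sup>2 \<le> B\<^sup>2 * \<epsilon>\<^sup>2" using sq(2) \<epsilon>2 by (simp add: mult.commute mult_left_mono)
    moreover have "\<bar>P - Vh\<^sup>2\<bar> \<le> \<bar>V\<^sup>2 - Vh\<^sup>2\<bar> + \<epsilon>\<^sup>2 * U\<^sup>2"
      unfolding P_def using abs_triangle_ineq4[of "V\<^sup>2 - Vh\<^sup>2" "\<epsilon>\<^sup>2 * U\<^sup>2"] by (simp add: abs_mult)
    moreover have "2 * (B\<^sup>2 * \<epsilon>\<^sup>2) \<le> M * \<epsilon>\<^sup>2" using \<epsilon>2 by (simp add: M_def algebra_simps)
    ultimately show ?thesis by linarith
  qed
  then have "real k * M ^ (k - 1) * \<bar>P - Vh\<^sup>2\<bar> \<le> real k * M ^ (k - 1) * (M * \<epsilon>\<^sup>2)"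
    using M(1) by (intro mult_left_mono) auto
  also have "\<dots> = real k * M ^ k * \<epsilon>\<^sup>2"
    using power_minus_mult[of k M] k by (simp add: algebra_simps)
  finally have P_Vh: "\<bar>P ^ k - Vh ^ (2 * k)\<bar> \<le> real k * M ^ k * \<epsilon>\<^sup>2"
    using abs_power_diff_le[OF M(2,5), of k] M(1) by (simp add: power_mult)
  note entries = W_entries_le[OF m k \<epsilon> e M(1-4)[unfolded P_def] P_Vh[unfolded P_def],
      unfolded V_def U_def Vh_def Uh_def M_def B_def]
  show ?thesis
    unfolding mat_opnorm_def W_mat_def Let_def v u
    by (rule onorm_W_shape_le[OF entries(1-4) entries(4-5)])
qed

theorem lemma5p3:
  fixes n k :: nat and m \<epsilon>1 :: real
    and F :: "real \<Rightarrow> real"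
    and v u Vt Ut :: "real \<Rightarrow> real \<Rightarrow> real"
  assumes n: "n \<in> {1, 2, 3}" and k: "k \<ge> 1" and k3: "n = 3 \<longrightarrow> k = 1"
    and m: "m > 0" and e1: "0 < \<epsilon>1" "\<epsilon>1 \<le> m"
    \<comment> \<open>F: positive radial H^1 solution of -\<Delta>F - F^(2k+1) = -F (even on R if n = 1)\<close>
    and F_C2: "C2_on (rdom n) F"
    and F_pos: "\<forall>R\<in>rdom n. F R > 0"
    and F_even: "n = 1 \<longrightarrow> (\<forall>x. F (- x) = F x)"
    and F_eq: "\<forall>R\<in>rdom n. - (deriv (deriv F) R + real (n - 1) / R * deriv F R)
                              - F R ^ (2 * k + 1) = - F R"
    and F_H1: "H1_sq n F < \<infinity>"
    \<comment> \<open>remainders, twice differentiable, with H^2 norms O(\<epsilon>^2)\<close>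
    and Vt_C2: "\<forall>\<epsilon>\<in>{0<..<\<epsilon>1}. C2_on (rdom n) (Vt \<epsilon>)"
    and Ut_C2: "\<forall>\<epsilon>\<in>{0<..<\<epsilon>1}. C2_on (rdom n) (Ut \<epsilon>)"
    and rem: "\<exists>C \<epsilon>0. 0 < \<epsilon>0 \<and> (\<forall>\<epsilon>\<in>{0<..<\<epsilon>0}. \<epsilon> < \<epsilon>1 \<longrightarrow>
                 H2_sq n (Vt \<epsilon>) \<le> ennreal ((C * \<epsilon>\<^sup>2)\<^sup>2) \<and>
                 H2_sq n (Ut \<epsilon>) \<le> ennreal ((C * \<epsilon>\<^sup>2)\<^sup>2))"
    \<comment> \<open>form of the solitary wave profile\<close>
    and v_def: "\<forall>\<epsilon>\<in>{0<..<\<epsilon>1}. \<forall>r\<in>rdom n.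
                 v \<epsilon> r = \<epsilon> powr (1 / real k) * (Vhat m k F (\<epsilon> * r) + Vt \<epsilon> (\<epsilon> * r))"
    and u_def: "\<forall>\<epsilon>\<in>{0<..<\<epsilon>1}. \<forall>r\<in>rdom n.
                 u \<epsilon> r = \<epsilon> powr (1 + 1 / real k) * (Uhat m k F (\<epsilon> * r) + Ut \<epsilon> (\<epsilon> * r))"
    \<comment> \<open>the profile equations, \<omega> = sqrt(m^2 - \<epsilon>^2)\<close>
    and eq1: "\<forall>\<epsilon>\<in>{0<..<\<epsilon>1}. \<forall>r\<in>rdom n.
                 sqrt (m\<^sup>2 - \<epsilon>\<^sup>2) * v \<epsilon> r = deriv (u \<epsilon>) r + real (n - 1) / r * u \<epsilon> r
                   + m * v \<epsilon> r - ((v \<epsilon> r)\<^sup>2 - (u \<epsilon> r)\<^sup>2) ^ k * v \<epsilon> r"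
    and eq2: "\<forall>\<epsilon>\<in>{0<..<\<epsilon>1}. \<forall>r\<in>rdom n.
                 sqrt (m\<^sup>2 - \<epsilon>\<^sup>2) * u \<epsilon> r = - deriv (v \<epsilon>) r - m * u \<epsilon> r
                   + ((v \<epsilon> r)\<^sup>2 - (u \<epsilon> r)\<^sup>2) ^ k * u \<epsilon> r"
  shows "\<exists>C \<epsilon>0. 0 < \<epsilon>0 \<and> \<epsilon>0 \<le> \<epsilon>1 \<and>
           (\<forall>\<epsilon>\<in>{0<..<\<epsilon>0}. \<forall>R\<in>rdom n. mat_opnorm (W_mat m k F (v \<epsilon>) (u \<epsilon>) \<epsilon> R) \<le> C * \<epsilon>\<^sup>2)"
proof -
  obtain M where M: "\<And>R. R \<in> rdom n \<Longrightarrow> \<bar>F R\<bar> \<le> M \<and> \<bar>deriv F R\<bar> \<le> M"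
    using ground_state_bounded[OF n k k3 F_C2 F_pos F_eq F_H1] by blast
  define A where "A = M * ((2 * m) powr (- 1 / (2 * real k)) + (2 * m) powr (- 1 / (2 * real k) - 1))"
  obtain C \<epsilon>0 where \<epsilon>0: "0 < \<epsilon>0" and H2: "\<And>\<epsilon>. \<epsilon> \<in> {0<..<\<epsilon>0} \<Longrightarrow> \<epsilon> < \<epsilon>1 \<Longrightarrow>
      H2_sq n (Vt \<epsilon>) \<le> ennreal ((C * \<epsilon>\<^sup>2)\<^sup>2) \<and> H2_sq n (Ut \<epsilon>) \<le> ennreal ((C * \<epsilon>\<^sup>2)\<^sup>2)"
    using rem by blast
  define K where "K = 3 * (\<bar>C\<bar> + 1)"
  show ?thesis
  proof (intro exI conjI ballI)
    show "0 < min (min \<epsilon>0 \<epsilon>1) 1" "min (min \<epsilon>0 \<epsilon>1) 1 \<le> \<epsilon>1" using \<epsilon>0 e1 by auto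
    fix \<epsilon> R assume \<epsilon>: "\<epsilon> \<in> {0<..<min (min \<epsilon>0 \<epsilon>1) 1}" and R: "R \<in> rdom n"
    then have \<epsilon>': "0 < \<epsilon>" "\<epsilon> \<le> 1" "\<epsilon> < m" "\<epsilon> \<in> {0<..<\<epsilon>1}" using e1 by auto
    have r: "R / \<epsilon> \<in> rdom n" "\<epsilon> * (R / \<epsilon>) = R" using \<epsilon>'(1) R by (auto simp: rdom_def)
    have e: "(\<epsilon> powr (1 / real k)) ^ k = \<epsilon>" "\<epsilon> powr (1 + 1 / real k) = \<epsilon> * \<epsilon> powr (1 / real k)"
      using \<epsilon>'(1) k by (simp_all add: powr_add powr_powr flip: powr_realpow)
    have "H2_sq n (Vt \<epsilon>) \<le> ennreal ((C * \<epsilon>\<^sup>2)\<^sup>2)" "H2_sq n (Ut \<epsilon>) \<le> ennreal ((C * \<epsilon>\<^sup>2)\<^sup>2)"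
      using H2[of \<epsilon>] \<epsilon> by auto
    then have "\<bar>Vt \<epsilon> R\<bar> \<le> K * \<epsilon>\<^sup>2" "\<bar>Ut \<epsilon> R\<bar> \<le> K * \<epsilon>\<^sup>2"
      unfolding K_def using Vt_C2 Ut_C2 \<epsilon>'(4)
      by (blast intro: abs_le_of_H2_sq_le_square[OF n _ _ \<epsilon>'(1) R])+
    moreover have "v \<epsilon> (R / \<epsilon>) = \<epsilon> powr (1 / real k) * (Vhat m k F R + Vt \<epsilon> R)"
      "u \<epsilon> (R / \<epsilon>) = \<epsilon> * \<epsilon> powr (1 / real k) * (Uhat m k F R + Ut \<epsilon> R)"
      using v_def u_def \<epsilon>'(4) r e(2) by simp_all
    moreover note abs_hat_profile_le[OF m M[OF R, THEN conjunct1] M[OF R, THEN conjunct2], of k,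
        folded A_def]
    ultimately show "mat_opnorm (W_mat m k F (v \<epsilon>) (u \<epsilon>) \<epsilon> R) \<le> 16 * W_bound m k (2 * (A + K)\<^sup>2 + 1) * \<epsilon>\<^sup>2"
      using mat_opnorm_W_mat_le[OF m k \<epsilon>'(1-3) e(1)] by (simp add: mult.assoc)
  qed
qed

end
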